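(* If $G$ is a planar ribbon graph, then the action $\beta_v$ of $\operatorname{Pic}^0(G)$ on $S(G)$ is independent of the vertex $v$, and hence defines a canonical action $\beta$ of $\operatorname{Pic}^0(G)$ on $S(G)$.
   Context: A graph means a finite connected multigraph without loop edges; a ribbon graph is a graph with a cyclic ordering of the edges around each vertex. A ribbon graph is planar if it can be embedded in $\mathbb{R}^2$ without crossings so that the cyclic orderings are those induced by the counterclockwise orientation of the plane (equivalently, the closed orientable surface determined by the ribbon structure has genus $0$). $S(G)$ is the set of spanning trees. Divisors are formal integer combinations of vertices. For $f : V(G) \to \mathbb{Z}$, $\Delta f = \sum_{u} \big(\sum_{\text{edges } uw} (f(u)-f(w))\big)(u)$; $D \sim D'$ if $D - D' = \Delta f$ for some $f$. $\operatorname{Pic}^d(G)$ is the set of linear equivalence classes of degree-$d$ divisors; $\operatorname{Pic}^0(G)$ is a group. The genus is $g = |E(G)|-|V(G)|+1$. For a spanning tree $T$ with non-tree edges $e_1,\dots,e_g$, a $T$-break divisor is $\sum_i (v_i)$ with $v_i$ an endpoint of $e_i$; $B(G)$ is the set of all such (over all $T$). Every class in $\operatorname{Pic}^g(G)$ contains exactly one element of $B(G)$, and $\operatorname{Pic}^0(G)$ acts on $B(G)$ by $\gamma \cdot D :=$ the unique break divisor linearly equivalent to $D + \gamma$. Bernardi map: for a vertex $v$, an edge $e$ incident to $v$, and a spanning tree $T$, the tour starts at $v$ and examines edges at $v$ in cyclic order starting with $e$; at a current vertex $u$, an examined edge $f \notin T$ is "cut through" from $u$ and the next edge at $u$ is examined,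 while an examined edge $f \in T$ is walked along to its other endpoint $u'$, after which the edges at $u'$ are examined in cyclic order starting with the edge after $f$. The tour ends when each tree edge has been traversed in both directions. For $f \notin T$, $\eta_{(v,e)}(f)$ is the endpoint from which $f$ is first cut through, and $\beta_{(v,e)}(T) = \sum_{f \notin T} (\eta_{(v,e)}(f))$; $\beta_{(v,e)} : S(G) \to B(G)$ is a bijection. The action $\beta_v$ is $\gamma \cdot T := \beta_{(v,e)}^{-1}(\gamma \cdot \beta_{(v,e)}(T))$ for any edge $e$ incident to $v$ (independent of $e$). *)

theory Defs
  imports Main
begin

text \<open>A graph: finite vertex set, finite edge set, each edge has an (unordered) pair
  of distinct endpoints (so multigraph without loops). A ribbon structure is a
  rotation: for each vertex v, rot v is a cyclic permutation (single cycle) of the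
  edges incident to v.\<close>

record ('v,'e) rgraph =
  verts :: "'v set"
  edges :: "'e set"
  ends  :: "'e \<Rightarrow> 'v \<times> 'v"
  rot   :: "'v \<Rightarrow> 'e \<Rightarrow> 'e"

definition incident :: "('v,'e) rgraph \<Rightarrow> 'v \<Rightarrow> 'e \<Rightarrow> bool" where
  "incident G v e \<longleftrightarrow> e \<in> edges G \<and> (v = fst (ends G e) \<or> v = snd (ends G e))"

definition other :: "('v,'e) rgraph \<Rightarrow> 'v \<Rightarrow> 'e \<Rightarrow> 'v" where
  "other G v e = (if v = fst (ends G e) then snd (ends G e) else fst (ends G e))"

definition inc_edges :: "('v,'e) rgraph \<Rightarrow> 'v \<Rightarrow> 'e set" where
  "inc_edges G v = {e. incident G v e}"

definition reach :: "('v,'e) rgraph \<Rightarrow> 'e set \<Rightarrow> 'v \<Rightarrow> 'v \<Rightarrow> bool" where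
  "reach G F = (\<lambda>u w. \<exists>e\<in>F. incident G u e \<and> w = other G u e)\<^sup>*\<^sup>*"

definition connected_by :: "('v,'e) rgraph \<Rightarrow> 'e set \<Rightarrow> bool" where
  "connected_by G F \<longleftrightarrow> (\<forall>u\<in>verts G. \<forall>w\<in>verts G. reach G F u w)"

definition is_graph :: "('v,'e) rgraph \<Rightarrow> bool" where
  "is_graph G \<longleftrightarrow> finite (verts G) \<and> finite (edges G) \<and>
     (\<forall>e\<in>edges G. fst (ends G e) \<in> verts G \<and> snd (ends G e) \<in> verts G
                  \<and> fst (ends G e) \<noteq> snd (ends G e)) \<and>
     connected_by G (edges G)"

definition ribbon_graph :: "('v,'e) rgraph \<Rightarrow> bool" where
  "ribbon_graph G \<longleftrightarrow> is_graph G \<and>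
     (\<forall>v\<in>verts G. bij_betw (rot G v) (inc_edges G v) (inc_edges G v) \<and>
        (\<forall>e\<in>inc_edges G v. \<forall>e'\<in>inc_edges G v. \<exists>n. (rot G v ^^ n) e = e'))"

text \<open>Darts (half-edges) and faces of the associated closed orientable surface.\<close>
definition darts :: "('v,'e) rgraph \<Rightarrow> ('v \<times> 'e) set" where
  "darts G = {(v,e). incident G v e}"

definition face_perm :: "('v,'e) rgraph \<Rightarrow> 'v \<times> 'e \<Rightarrow> 'v \<times> 'e" where
  "face_perm G d = (let w = other G (fst d) (snd d) in (w, rot G w (snd d)))"

definition faces :: "('v,'e) rgraph \<Rightarrow> ('v \<times> 'e) set set" where
  "faces G = (\<lambda>d. {(face_perm G ^^ n) d | n. True}) ` darts G"

text \<open>Planar: the surface has genus 0, i.e. V - E + F = 2.\<close>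
definition planar :: "('v,'e) rgraph \<Rightarrow> bool" where
  "planar G \<longleftrightarrow> int (card (verts G)) - int (card (edges G)) + int (card (faces G)) = 2"

text \<open>Spanning trees: connected spanning subgraphs without cycles (every edge is a bridge).\<close>
definition spanning_tree :: "('v,'e) rgraph \<Rightarrow> 'e set \<Rightarrow> bool" where
  "spanning_tree G T \<longleftrightarrow> T \<subseteq> edges G \<and> connected_by G T \<and>
     (\<forall>t\<in>T. \<not> reach G (T - {t}) (fst (ends G t)) (snd (ends G t)))"

definition S :: "('v,'e) rgraph \<Rightarrow> 'e set set" where
  "S G = {T. spanning_tree G T}"

type_synonym 'v divisor = "'v \<Rightarrow> int"

definition divisors :: "('v,'e) rgraph \<Rightarrow> 'v divisor set" where
  "divisors G = {D. \<forall>x. x \<notin> verts G \<longrightarrow> D x = 0}"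

definition deg :: "('v,'e) rgraph \<Rightarrow> 'v divisor \<Rightarrow> int" where
  "deg G D = (\<Sum>x\<in>verts G. D x)"

definition laplacian :: "('v,'e) rgraph \<Rightarrow> ('v \<Rightarrow> int) \<Rightarrow> 'v divisor" where
  "laplacian G f = (\<lambda>u. \<Sum>e\<in>inc_edges G u. f u - f (other G u e))"

definition lin_equiv :: "('v,'e) rgraph \<Rightarrow> 'v divisor \<Rightarrow> 'v divisor \<Rightarrow> bool" where
  "lin_equiv G D D' \<longleftrightarrow> (\<exists>f. (\<lambda>u. D u - D' u) = laplacian G f)"

definition break_divisors :: "('v,'e) rgraph \<Rightarrow> 'v divisor set" where
  "break_divisors G = {D. \<exists>T\<in>S G. \<exists>ch. (\<forall>f\<in>edges G - T. incident G (ch f) f) \<and>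
      D = (\<lambda>x. int (card {f\<in>edges G - T. ch f = x}))}"

definition break_act :: "('v,'e) rgraph \<Rightarrow> 'v divisor \<Rightarrow> 'v divisor \<Rightarrow> 'v divisor" where
  "break_act G \<gamma> D = (THE D'. D' \<in> break_divisors G \<and> lin_equiv G D' (\<lambda>x. D x + \<gamma> x))"

definition tour_step :: "('v,'e) rgraph \<Rightarrow> 'e set \<Rightarrow> 'v \<times> 'e \<Rightarrow> 'v \<times> 'e" where
  "tour_step G T d = (let u = fst d; f = snd d in
     if f \<in> T then (let w = other G u f in (w, rot G w f)) else (u, rot G u f))"

text \<open>Number of examined darts: the tour ends once every tree edge has been
  traversed in both directions.\<close>
definition tour_len :: "('v,'e) rgraph \<Rightarrow> 'v \<Rightarrow> 'e \<Rightarrow> 'e set \<Rightarrow> nat" where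
  "tour_len G v e T = (LEAST n. \<forall>t\<in>T. \<forall>x. incident G x t \<longrightarrow>
       (\<exists>k<n. (tour_step G T ^^ k) (v,e) = (x,t)))"

definition eta :: "('v,'e) rgraph \<Rightarrow> 'v \<Rightarrow> 'e \<Rightarrow> 'e set \<Rightarrow> 'e \<Rightarrow> 'v" where
  "eta G v e T f = (THE x. incident G x f \<and>
      (\<exists>k<tour_len G v e T. (tour_step G T ^^ k) (v,e) = (x,f) \<and>
          (\<forall>j<k. snd ((tour_step G T ^^ j) (v,e)) \<noteq> f)))"

definition bernardi :: "('v,'e) rgraph \<Rightarrow> 'v \<Rightarrow> 'e \<Rightarrow> 'e set \<Rightarrow> 'v divisor" where
  "bernardi G v e T = (\<lambda>x. int (card {f\<in>edges G - T. eta G v e T f = x}))"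

text \<open>The action beta_(v,e) of Pic^0(G) on S(G); gamma is a degree-0 divisor
  representing its class.\<close>
definition bernardi_action :: "('v,'e) rgraph \<Rightarrow> 'v \<Rightarrow> 'e \<Rightarrow> 'v divisor \<Rightarrow> 'e set \<Rightarrow> 'e set" where
  "bernardi_action G v e \<gamma> T =
     inv_into (S G) (bernardi G v e) (break_act G \<gamma> (bernardi G v e T))"

end

theory Submission
  imports Defs
begin

text \<open>
  For a spanning tree \<open>T\<close>, the tour is a single cycle on all darts, and \<open>\<beta>(T)\<close> records which dart of
  each non-tree edge comes first. Rotating the starting dart from \<open>(v, e)\<close> to the next dart at \<open>v\<close>
  changes \<open>\<beta>(T)\<close> by \<open>(w) - (v)\<close> up to a principal divisor, where \<open>w\<close> is the other end of \<open>e\<close>: if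
  \<open>e \<notin> T\<close>, only \<open>e\<close> is cut from its other end, and if \<open>e \<in> T\<close>, exactly the edges of the fundamental
  cut of \<open>e\<close> are. On a planar ribbon graph moving the start along a face does not change
  \<open>\<beta>(T)\<close> at all, because by Euler's formula no two non-tree edges interleave in the tour: each
  of the \<open>g\<close> transpositions that turn the tour into the face permutation has to split a cycle.
  Hence two Bernardi maps differ, up to linear equivalence, by a divisor independent of \<open>T\<close>.

  It remains that \<open>\<beta>\<close> meets every class of degree \<open>g\<close> exactly once. Call \<open>D\<close> feasible if
  \<open>D(A) \<ge> |E(A)| - |A| + 1\<close> for all nonempty \<open>A\<close>, with equality for \<open>A = V\<close>. Break divisors are
  feasible, every class contains exactly one feasible divisor (a minimiser of an energy; the
  maximum principle), and a feasible divisor is \<open>\<beta>(T)\<close> for the tree built by the greedy tour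
  that cuts an edge whenever the remaining divisor stays feasible on the remaining graph.
\<close>

section \<open>Orbits of finite permutations\<close>

text \<open>The obstacle is that \<open>eta\<close>, \<open>break_act\<close> and
  \<open>inv_into\<close> are choice operators: an action built from them says nothing until
  existence and uniqueness are proved. Feasibility serves this purpose because it is a family of
  linear inequalities, which can be added, complemented and minimised over, whereas membership in
  \<open>break_divisors G\<close> hides a tree and a choice of ends. The map
  \<open>tour_step G F\<close> is studied for every edge set \<open>F\<close>, not only for trees.
  For \<open>F = {}\<close> its cycles are the rotations at the vertices, for \<open>F = E\<close>
  they are the faces, and one more edge in \<open>F\<close> means one transposition of darts. That a
  tree has a single cycle and that planar tours do not interleave are both read off from merging and
  splitting of cycles. A greedy tour that builds its tree on the way does not fit
  \<open>tour_step\<close> and \<open>eta\<close>, which ask for a complete tree. Surjectivity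
  therefore carries a whole spanning tree and repairs it by exchanging edges not yet examined, which
  leaves the past of the tour intact. Tight vertex sets are the certificates that such an exchange
  exists.\<close>

definition orb :: "('a \<Rightarrow> 'a) \<Rightarrow> 'a \<Rightarrow> 'a set" where
  "orb p x = {(p ^^ n) x | n. True}"

lemma orb_iterate: "(p ^^ n) x \<in> orb p x"
  by (auto simp: orb_def)

lemma orb_self: "x \<in> orb p x"
  using orb_iterate[of 0] by simp

lemma orb_step: "y \<in> orb p x \<Longrightarrow> p y \<in> orb p x"
  using orb_iterate[of "Suc _"] by (auto simp: orb_def)

lemma orb_trans:
  assumes "y \<in> orb p x" "z \<in> orb p y" shows "z \<in> orb p x"
proof -
  obtain m n where "y = (p ^^ m) x" "z = (p ^^ n) y" using assms by (auto simp: orb_def)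
  then have "z = (p ^^ (n + m)) x" by (simp add: funpow_add)
  then show ?thesis using orb_iterate by metis
qed

lemma funpow_in:
  assumes "bij_betw p X X" "x \<in> X" shows "(p ^^ n) x \<in> X"
  using assms by (induction n) (auto simp: bij_betw_def)

lemma funpow_period:
  assumes fin: "finite X" and p: "bij_betw p X X" and x: "x \<in> X"
  obtains n where "n > 0" "(p ^^ n) x = x"
proof -
  have "\<not> inj (\<lambda>n. (p ^^ n) x)"
  proof
    assume "inj (\<lambda>n. (p ^^ n) x)"
    moreover have "range (\<lambda>n. (p ^^ n) x) \<subseteq> X" using funpow_in[OF p x] by auto
    ultimately show False using fin finite_subset[of _ X] finite_imageD infinite_UNIV_nat by blast
  qed
  then obtain i j where ij: "i < j" "(p ^^ i) x = (p ^^ j) x"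
    unfolding inj_def by (metis linorder_neqE_nat)
  have "inj_on (p ^^ i) X"
    using p by (metis bij_betw_def bij_betw_funpow)
  moreover have "(p ^^ i) ((p ^^ (j - i)) x) = (p ^^ i) x"
    using ij by (metis add_diff_inverse_nat comp_apply funpow_add less_imp_le not_less)
  ultimately have "(p ^^ (j - i)) x = x"
    using funpow_in[OF p x] x by (meson inj_onD)
  then show thesis using ij that[of "j - i"] by simp
qed

lemma orb_sym:
  assumes "finite X" "bij_betw p X X" "x \<in> X" "y \<in> orb p x"
  shows "x \<in> orb p y"
proof -
  obtain m where m: "y = (p ^^ m) x" using assms(4) by (auto simp: orb_def)
  obtain n where n: "n > 0" "(p ^^ n) x = x" using funpow_period assms by metis
  have per: "(p ^^ (n * q)) x = x" for q
    by (induction q) (use n in \<open>auto simp: funpow_add\<close>)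
  have "(p ^^ (n * m - m)) y = (p ^^ (n * m - m + m)) x" by (simp add: m funpow_add)
  also have "\<dots> = x" using per[of m] n by simp
  finally show ?thesis using orb_iterate by metis
qed

lemma orb_eq:
  assumes "finite X" "bij_betw p X X" "x \<in> X" "y \<in> orb p x"
  shows "orb p y = orb p x"
  using orb_trans[OF assms(4)] orb_trans[OF orb_sym[OF assms]] by blast

section \<open>Cycle counts under multiplication by a transposition\<close>

definition orbits :: "'a set \<Rightarrow> ('a \<Rightarrow> 'a) \<Rightarrow> 'a set set" where
  "orbits X p = orb p ` X"

text \<open>\<open>p'\<close> is \<open>p\<close> after the transposition of \<open>a\<close> and
  \<open>b\<close>. The situation is symmetric in \<open>a\<close>, \<open>b\<close> and in
  \<open>p\<close>, \<open>p'\<close>; the locale is interpreted again with these roles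
  exchanged.\<close>

locale swapped_perm =
  fixes X :: "'a set" and p p' :: "'a \<Rightarrow> 'a" and a b :: 'a
  assumes fin: "finite X" and p: "bij_betw p X X" and p': "bij_betw p' X X"
    and a: "a \<in> X" and b: "b \<in> X"
    and swap: "p' a = p b" "p' b = p a" "\<And>z. z \<in> X \<Longrightarrow> z \<noteq> a \<Longrightarrow> z \<noteq> b \<Longrightarrow> p' z = p z"
begin

lemma orb_away:
  assumes z: "z \<in> X" and "a \<notin> orb p' z" "b \<notin> orb p' z"
  shows "orb p z = orb p' z"
proof -
  have "(p' ^^ n) z = (p ^^ n) z" for n
  proof (induction n)
    case (Suc n)
    have "(p' ^^ n) z \<noteq> a" "(p' ^^ n) z \<noteq> b" using assms orb_iterate by metis+
    then have "p' ((p' ^^ n) z) = p ((p' ^^ n) z)" by (simp add: swap(3) funpow_in[OF p' z])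
    then show ?case using Suc by simp
  qed simp
  then show ?thesis by (simp add: orb_def)
qed

text \<open>A cycle that avoids both \<open>a\<close> and \<open>b\<close> is the same for
  \<open>p\<close> and \<open>p'\<close>, so the counts only concern at most two old and two new
  cycles.\<close>

lemma orbits_subset:
  "orbits X p' \<subseteq> (orbits X p - {orb p a, orb p b}) \<union> {orb p' a, orb p' b}"
proof
  fix O' assume "O' \<in> orbits X p'"
  then obtain z where z: "z \<in> X" "O' = orb p' z" by (auto simp: orbits_def)
  show "O' \<in> (orbits X p - {orb p a, orb p b}) \<union> {orb p' a, orb p' b}"
  proof (cases "a \<in> O' \<or> b \<in> O'")
    case True
    then show ?thesis using orb_eq[OF fin p' z(1)] z(2) by auto
  next
    case False
    then show ?thesis using orb_away[OF z(1)] z orb_self by (fastforce simp: orbits_def)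
  qed
qed

lemma card_orbits_le: "card (orbits X p') \<le> card (orbits X p) + 1"
proof -
  have f: "finite (orbits X p)" using fin by (simp add: orbits_def)
  have "card (orbits X p') \<le> card ((orbits X p - {orb p a, orb p b}) \<union> {orb p' a, orb p' b})"
    using orbits_subset f by (intro card_mono) auto
  also have "\<dots> \<le> card (orbits X p - {orb p a, orb p b}) + card {orb p' a, orb p' b}"
    by (rule card_Un_le)
  also have "\<dots> \<le> card (orbits X p - {orb p a}) + 2"
    using f by (intro add_mono card_mono) (auto simp: card_insert_le_m1)
  also have "\<dots> = card (orbits X p) + 1"
  proof -
    have "orb p a \<in> orbits X p" using a by (auto simp: orbits_def)
    then have "card (orbits X p - {orb p a}) + 1 = card (orbits X p)"
      using card.remove[OF f] by simp
    then show ?thesis by simp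
  qed
  finally show ?thesis .
qed

text \<open>The two cycles in fact merge into one; the absence of growth is what the genus count
  uses.\<close>

lemma card_orbits_merge_le:
  assumes "orb p a \<noteq> orb p b" shows "card (orbits X p') \<le> card (orbits X p)"
proof -
  have f: "finite (orbits X p)" using fin by (simp add: orbits_def)
  have sub: "{orb p a, orb p b} \<subseteq> orbits X p" using a b by (auto simp: orbits_def)
  have "card (orbits X p') \<le> card ((orbits X p - {orb p a, orb p b}) \<union> {orb p' a, orb p' b})"
    using orbits_subset f by (intro card_mono) auto
  also have "\<dots> \<le> card (orbits X p - {orb p a, orb p b}) + card {orb p' a, orb p' b}"
    by (rule card_Un_le)
  also have "\<dots> \<le> (card (orbits X p) - 2) + 2"
    using card_Diff_subset[OF _ sub] assms by (intro add_mono) (auto simp: card_insert_le_m1)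
  also have "\<dots> = card (orbits X p)"
    using card_mono[OF f sub] assms by simp
  finally show ?thesis .
qed

text \<open>From \<open>a\<close> the map \<open>p'\<close> enters the old cycle of \<open>b\<close>
  at \<open>p b\<close> and follows it until it closes at \<open>b\<close>, since \<open>a\<close>
  is not met on the way.\<close>

lemma orb_merge_subset:
  assumes ab: "b \<notin> orb p a" shows "orb p b \<subseteq> orb p' a"
proof -
  have na: "(p ^^ n) b \<noteq> a" for n
    using ab orb_sym[OF fin p b] orb_iterate by metis
  have "(p ^^ Suc n) b \<in> orb p' a" for n
  proof (induction n)
    case 0
    show ?case using orb_step[OF orb_self, of p' a] swap(1) by simp
  next
    case (Suc n)
    show ?case
    proof (cases "(p ^^ Suc n) b = b")
      case True
      then show ?thesis using orb_step[OF orb_self, of p' a] swap(1) by simp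
    next
      case False
      then have "p' ((p ^^ Suc n) b) = p ((p ^^ Suc n) b)"
        using na by (intro swap(3)) (rule funpow_in[OF p b])
      then show ?thesis using orb_step[OF Suc] by simp
    qed
  qed
  note * = this
  obtain m where m: "m > 0" "(p ^^ m) b = b" using funpow_period[OF fin p b] by metis
  have "(p ^^ n) b \<in> orb p' a" for n
    using *[of "n - 1"] *[of "m - 1"] m by (cases n) auto
  then show ?thesis by (auto simp: orb_def)
qed

text \<open>The second claim is a monotonicity: merging breaks no old cycle apart. It carries the
  induction over the edges of a forest.\<close>

lemma orb_merge:
  assumes ab: "b \<notin> orb p a"
  shows "b \<in> orb p' a" and "z \<in> X \<Longrightarrow> y \<in> orb p z \<Longrightarrow> y \<in> orb p' z"
proof -
  interpret s: swapped_perm X p p' b a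
    by unfold_locales (simp_all add: fin p p' a b swap)
  have ba: "a \<notin> orb p b" using ab orb_sym[OF fin p b] by blast
  show 1: "b \<in> orb p' a" by (rule subsetD[OF orb_merge_subset[OF ab] orb_self])
  then have eq: "orb p' b = orb p' a" by (rule orb_eq[OF fin p' a])
  have A: "orb p a \<subseteq> orb p' a" using s.orb_merge_subset[OF ba] eq by simp
  have B: "orb p b \<subseteq> orb p' a" using orb_merge_subset[OF ab] .
  show "y \<in> orb p' z" if z: "z \<in> X" and y: "y \<in> orb p z"
  proof (cases "a \<in> orb p' z \<or> b \<in> orb p' z")
    case True
    then have e: "orb p' z = orb p' a" using eq orb_eq[OF fin p' z] by blast
    show ?thesis
    proof (cases "a \<in> orb p z \<or> b \<in> orb p z")
      case True
      then have "orb p z = orb p a \<or> orb p z = orb p b" using orb_eq[OF fin p z] by blast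
      then show ?thesis using e A B y by blast
    next
      case False
      interpret t: swapped_perm X p' p a b
        by unfold_locales (simp_all add: fin p p' a b swap)
      show ?thesis using t.orb_away[OF z] False y by auto
    qed
  next
    case False
    then show ?thesis using orb_away[OF z] y by simp
  qed
qed

end

section \<open>Positions along a single cycle\<close>

definition pos :: "('a \<Rightarrow> 'a) \<Rightarrow> 'a \<Rightarrow> 'a \<Rightarrow> nat" where
  "pos p x y = (LEAST k. (p ^^ k) x = y)"

locale single_cycle =
  fixes X :: "'a set" and p :: "'a \<Rightarrow> 'a" and x :: 'a
  assumes fin: "finite X" and p: "bij_betw p X X" and x: "x \<in> X" and cyc: "X \<subseteq> orb p x"
begin

lemma funpow_pos: "y \<in> X \<Longrightarrow> (p ^^ pos p x y) x = y"
proof -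
  assume "y \<in> X"
  then have "\<exists>k. (p ^^ k) x = y" using cyc by (auto simp: orb_def)
  then show ?thesis unfolding pos_def by (rule LeastI_ex)
qed

lemma bij_enum: "bij_betw (\<lambda>k. (p ^^ k) x) {..<card X} X" and funpow_card: "(p ^^ card X) x = x"
proof -
  define m where "m = (LEAST n. 0 < n \<and> (p ^^ n) x = x)"
  have m: "0 < m" "(p ^^ m) x = x"
    using funpow_period[OF fin p x] LeastI[of "\<lambda>n. 0 < n \<and> (p ^^ n) x = x"]
    unfolding m_def by metis+
  have least: "n < m \<Longrightarrow> 0 < n \<Longrightarrow> (p ^^ n) x \<noteq> x" for n
    using not_less_Least unfolding m_def by blast
  have im: "(\<lambda>k. (p ^^ k) x) ` {..<m} = X"
  proof
    show "(\<lambda>k. (p ^^ k) x) ` {..<m} \<subseteq> X" using funpow_in[OF p x] by auto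
    show "X \<subseteq> (\<lambda>k. (p ^^ k) x) ` {..<m}"
    proof
      fix y assume "y \<in> X"
      then obtain n where "y = (p ^^ n) x" using cyc by (auto simp: orb_def)
      then have "y = (p ^^ (n mod m)) x" using funpow_mod_eq[OF m(2)] by simp
      then show "y \<in> (\<lambda>k. (p ^^ k) x) ` {..<m}" using m(1) by auto
    qed
  qed
  have inj: "inj_on (\<lambda>k. (p ^^ k) x) {..<m}"
  proof (rule linorder_inj_onI)
    fix i j assume ij: "i < j" "i \<in> {..<m}" "j \<in> {..<m}"
    show "(p ^^ i) x \<noteq> (p ^^ j) x"
    proof
      assume eq: "(p ^^ i) x = (p ^^ j) x"
      have "(p ^^ (m - j + i)) x = (p ^^ (m - j + j)) x"
        using eq by (simp add: funpow_add)
      moreover have "m - j + j = m" using ij by simp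
      ultimately have "(p ^^ (m - j + i)) x = x" using m by simp
      moreover have "m - j + i < m" "0 < m - j + i" using ij by auto
      ultimately show False using least by metis
    qed
  qed auto
  have "m = card X" using card_image[OF inj] im by simp
  then show "bij_betw (\<lambda>k. (p ^^ k) x) {..<card X} X" "(p ^^ card X) x = x"
    using im inj m(2) unfolding bij_betw_def by simp_all
qed

lemma pos_less: "y \<in> X \<Longrightarrow> pos p x y < card X"
proof -
  assume y: "y \<in> X"
  then have "y \<in> (\<lambda>k. (p ^^ k) x) ` {..<card X}" using bij_enum by (simp add: bij_betw_def)
  then obtain k where k: "k < card X" "(p ^^ k) x = y" by auto
  then show ?thesis unfolding pos_def using Least_le[of "\<lambda>k. (p ^^ k) x = y" k] by simp
qed

lemma pos_funpow: "k < card X \<Longrightarrow> pos p x ((p ^^ k) x) = k"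
  using bij_enum pos_less[OF funpow_in[OF p x]] funpow_pos[OF funpow_in[OF p x]]
  unfolding bij_betw_def inj_on_def by (metis lessThan_iff)

lemma pos_inj: "y \<in> X \<Longrightarrow> z \<in> X \<Longrightarrow> pos p x y = pos p x z \<Longrightarrow> y = z"
  using funpow_pos by metis

lemma pos_self: "pos p x x = 0"
  by (simp add: pos_def)

lemma pos_step:
  assumes "y \<in> X" "pos p x y + 1 < card X"
  shows "pos p x (p y) = pos p x y + 1"
  using pos_funpow[OF assms(2)] funpow_pos[OF assms(1)] by simp

lemma pos_eqI: "k < card X \<Longrightarrow> (p ^^ k) x = y \<Longrightarrow> pos p x y = k"
  using pos_funpow by blast

text \<open>Positions before the new start move to the end. The full turn \<open>m = card X\<close>
  is included because it occurs when the tour round a tree edge comes back to a leaf.\<close>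

lemma pos_rotate:
  assumes m: "m \<le> card X" and y: "y \<in> X"
  shows "pos p ((p ^^ m) x) y =
    (if m \<le> pos p x y then pos p x y - m else pos p x y + card X - m)"
proof -
  let ?x' = "(p ^^ m) x"
  have x': "?x' \<in> X" by (rule funpow_in[OF p x])
  interpret s: single_cycle X p ?x'
  proof
    show "X \<subseteq> orb p ?x'" unfolding orb_eq[OF fin p x orb_iterate] by (rule cyc)
  qed (rule fin p x')+
  let ?k = "if m \<le> pos p x y then pos p x y - m else pos p x y + card X - m"
  have "?k < card X" using pos_less[OF y] m by auto
  moreover have "(p ^^ ?k) ?x' = y"
  proof -
    have "(p ^^ ?k) ?x' = (p ^^ (?k + m)) x" by (simp add: funpow_add)
    also have "?k + m = (if m \<le> pos p x y then pos p x y else pos p x y + card X)"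
      using m by auto
    also have "(p ^^ \<dots>) x = y" using funpow_pos[OF y] funpow_card by (auto simp: funpow_add)
    finally show ?thesis .
  qed
  ultimately show ?thesis by (rule s.pos_eqI)
qed

end

section \<open>Tours as cyclic permutations of the darts\<close>

locale ribbon =
  fixes G :: "('v,'e) rgraph"
  assumes ribbon: "ribbon_graph G"
begin

abbreviation "V \<equiv> verts G"
abbreviation "E \<equiv> edges G"
abbreviation "tl_end f \<equiv> fst (ends G f)"
abbreviation "hd_end f \<equiv> snd (ends G f)"

lemma finite_V [simp]: "finite V" and finite_E [simp]: "finite E"
  using ribbon by (auto simp: ribbon_graph_def is_graph_def)

lemma finite_edges: "F \<subseteq> E \<Longrightarrow> finite F" and finite_verts: "A \<subseteq> V \<Longrightarrow> finite A"
  using finite_subset finite_V finite_E by blast+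

lemma ends_in: "f \<in> E \<Longrightarrow> tl_end f \<in> V" "f \<in> E \<Longrightarrow> hd_end f \<in> V"
  and ends_neq: "f \<in> E \<Longrightarrow> tl_end f \<noteq> hd_end f"
  using ribbon by (auto simp: ribbon_graph_def is_graph_def)

lemma connected: "connected_by G E"
  using ribbon by (auto simp: ribbon_graph_def is_graph_def)

lemma incident_ends: "f \<in> E \<Longrightarrow> incident G (tl_end f) f" "f \<in> E \<Longrightarrow> incident G (hd_end f) f"
  by (auto simp: incident_def)

lemma incident_in: "incident G u f \<Longrightarrow> u \<in> V" "incident G u f \<Longrightarrow> f \<in> E"
  using ends_in by (auto simp: incident_def)

lemma other_ends: "f \<in> E \<Longrightarrow> other G (tl_end f) f = hd_end f" "f \<in> E \<Longrightarrow> other G (hd_end f) f = tl_end f"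
  using ends_neq by (auto simp: other_def)

lemma other_incident: "incident G u f \<Longrightarrow> incident G (other G u f) f"
  by (auto simp: incident_def other_def)

lemma other_other: "incident G u f \<Longrightarrow> other G (other G u f) f = u"
  using ends_neq by (auto simp: incident_def other_def)

lemma other_neq: "incident G u f \<Longrightarrow> other G u f \<noteq> u"
  using ends_neq[of f] ends_neq[of f, symmetric] by (auto simp: incident_def other_def)

lemma incident_cases: "incident G u f \<Longrightarrow> incident G w f \<Longrightarrow> w = u \<or> w = other G u f"
  by (auto simp: incident_def other_def)

lemma darts_iff: "(u, f) \<in> darts G \<longleftrightarrow> incident G u f"
  by (simp add: darts_def)

lemma finite_darts: "finite (darts G)"
proof (rule finite_subset)
  show "darts G \<subseteq> V \<times> E" using incident_in by (auto simp: darts_def)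
qed simp

lemma rot_incident: "incident G u f \<Longrightarrow> incident G u (rot G u f)"
  using ribbon incident_in(1) unfolding ribbon_graph_def bij_betw_def inc_edges_def by blast

lemma rot_bij: "u \<in> V \<Longrightarrow> bij_betw (rot G u) (inc_edges G u) (inc_edges G u)"
  using ribbon by (auto simp: ribbon_graph_def)

lemma rot_transitive: "incident G u f \<Longrightarrow> incident G u g \<Longrightarrow> \<exists>n. (rot G u ^^ n) f = g"
  using ribbon incident_in(1) unfolding ribbon_graph_def inc_edges_def by blast

lemma tour_step_in: "f \<in> T \<Longrightarrow> tour_step G T (u, f) = (other G u f, rot G (other G u f) f)"
  and tour_step_notin: "f \<notin> T \<Longrightarrow> tour_step G T (u, f) = (u, rot G u f)"
  by (simp_all add: tour_step_def Let_def)

lemma tour_step_bij: "bij_betw (tour_step G T) (darts G) (darts G)"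
proof -
  let ?flip = "\<lambda>d. if snd d \<in> T then (other G (fst d) (snd d), snd d) else d"
  let ?rot = "\<lambda>d. (fst d, rot G (fst d) (snd d))"
  have "bij_betw ?flip (darts G) (darts G)"
    by (rule bij_betw_byWitness[where f' = ?flip])
      (auto simp: darts_iff other_incident other_other)
  moreover have "inj_on ?rot (darts G)"
  proof (rule inj_onI)
    fix d d' assume a: "d \<in> darts G" "d' \<in> darts G" "?rot d = ?rot d'"
    obtain u f where d: "d = (u, f)" by fastforce
    obtain u' f' where d': "d' = (u', f')" by fastforce
    have "inj_on (rot G u) (inc_edges G u)"
      using rot_bij a(1) incident_in(1) d by (auto simp: bij_betw_def darts_iff)
    moreover have "f \<in> inc_edges G u" "f' \<in> inc_edges G u" "rot G u f = rot G u f'"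
      using a d d' by (auto simp: inc_edges_def darts_iff)
    ultimately show "d = d'" using a d d' by (auto dest: inj_onD)
  qed
  moreover have "?rot ` darts G \<subseteq> darts G" using rot_incident by (auto simp: darts_iff)
  ultimately have "bij_betw ?flip (darts G) (darts G)" "bij_betw ?rot (darts G) (darts G)"
    using endo_inj_surj[OF finite_darts, of ?rot] by (simp_all add: bij_betw_def)
  then have "bij_betw (?rot \<circ> ?flip) (darts G) (darts G)" by (rule bij_betw_trans)
  moreover have "?rot \<circ> ?flip = tour_step G T"
    by (simp add: fun_eq_iff tour_step_def Let_def)
  ultimately show ?thesis by simp
qed

lemma face_perm_tour: "d \<in> darts G \<Longrightarrow> (face_perm G ^^ n) d = (tour_step G E ^^ n) d"
proof (induction n)
  case (Suc n)
  have "(tour_step G E ^^ n) d \<in> darts G" using funpow_in[OF tour_step_bij Suc.prems] .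
  then have E: "snd ((tour_step G E ^^ n) d) \<in> E" using incident_in by (auto simp: darts_def)
  have "(face_perm G ^^ Suc n) d = face_perm G ((tour_step G E ^^ n) d)" using Suc by simp
  also have "\<dots> = tour_step G E ((tour_step G E ^^ n) d)"
    using E unfolding face_perm_def tour_step_def Let_def by simp
  finally show ?case by simp
qed simp

lemma faces_orbits: "faces G = orbits (darts G) (tour_step G E)"
  using face_perm_tour by (auto simp: faces_def orbits_def orb_def intro!: image_cong)

text \<open>Crossing \<open>t\<close> or staying only decides at which end the rotation is applied,
  so the images of the two darts of \<open>t\<close> are exchanged.\<close>

lemma tour_step_swapped:
  assumes t: "incident G x t" "t \<notin> F"
  shows "swapped_perm (darts G) (tour_step G F) (tour_step G (insert t F)) (x, t) (other G x t, t)"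
proof unfold_locales
  show "tour_step G (insert t F) (x, t) = tour_step G F (other G x t, t)"
    "tour_step G (insert t F) (other G x t, t) = tour_step G F (x, t)"
    using t by (auto simp: tour_step_def Let_def other_other)
  fix z assume z: "z \<in> darts G" "z \<noteq> (x, t)" "z \<noteq> (other G x t, t)"
  have "snd z \<noteq> t" using z incident_cases[OF t(1), of "fst z"] by (cases z) (auto simp: darts_def)
  then show "tour_step G (insert t F) z = tour_step G F z"
    by (auto simp: tour_step_def Let_def)
qed (use t in \<open>auto simp: finite_darts tour_step_bij darts_iff other_incident\<close>)

section \<open>Connectivity, forests and spanning trees\<close>

lemma reach_refl: "reach G F u u"
  by (simp add: reach_def)

lemma reach_trans: "reach G F u w \<Longrightarrow> reach G F w x \<Longrightarrow> reach G F u x"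
  unfolding reach_def by (rule rtranclp_trans)

lemma reach_edge: "f \<in> F \<Longrightarrow> incident G u f \<Longrightarrow> reach G F u (other G u f)"
  unfolding reach_def by blast

lemma reach_induct [consumes 1, case_names refl step]:
  assumes "reach G F u w" "P u"
    "\<And>x f. reach G F u x \<Longrightarrow> P x \<Longrightarrow> f \<in> F \<Longrightarrow> incident G x f \<Longrightarrow> P (other G x f)"
  shows "P w"
  using assms(1) unfolding reach_def
  by (induction rule: rtranclp_induct) (use assms(2,3) in \<open>auto simp: reach_def\<close>)

lemma reach_sym: "reach G F u w \<Longrightarrow> reach G F w u"
proof (induction rule: reach_induct)
  case (step x f)
  have "reach G F (other G x f) x"
    using reach_edge[OF step(2) other_incident[OF step(3)]] other_other[OF step(3)] by simp
  then show ?case using step reach_trans by blast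
qed (rule reach_refl)

lemma reach_mono: "reach G F u w \<Longrightarrow> F \<subseteq> F' \<Longrightarrow> reach G F' u w"
proof (induction rule: reach_induct)
  case (step x f)
  then show ?case using reach_trans reach_edge by (meson subsetD)
qed (rule reach_refl)

lemma reach_exit:
  assumes "reach G F u w" "u \<in> A" "w \<notin> A"
  obtains x f where "f \<in> F" "incident G x f" "x \<in> A" "other G x f \<notin> A" "reach G F u x"
proof -
  have "w \<in> A \<or> (\<exists>x f. f \<in> F \<and> incident G x f \<and> x \<in> A \<and> other G x f \<notin> A \<and> reach G F u x)"
    using assms(1) by (induction rule: reach_induct) (use assms(2) in blast)+
  then show thesis using assms that by blast
qed

text \<open>After the last use of \<open>t\<close> a walk starts from an end of \<open>t\<close> and
  avoids it.\<close>

lemma reach_remove: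
  assumes "reach G F u w" "incident G x t"
  shows "reach G (F - {t}) u w \<or> reach G (F - {t}) x w \<or> reach G (F - {t}) (other G x t) w"
  using assms(1)
proof (induction rule: reach_induct)
  case (step y f)
  show ?case
  proof (cases "f = t")
    case True
    then have "other G y f = x \<or> other G y f = other G x t"
      using incident_cases[OF assms(2)] other_incident[OF step(3)] by blast
    then show ?thesis using reach_refl by metis
  next
    case False
    then have "reach G (F - {t}) y (other G y f)" using reach_edge step by simp
    then show ?thesis using step reach_trans by metis
  qed
qed (simp add: reach_refl)

lemma bridge_sides:
  assumes "connected_by G F" "incident G x t" "u \<in> V"
  shows "reach G (F - {t}) x u \<or> reach G (F - {t}) (other G x t) u"
  using reach_remove[OF _ assms(2), of F x u] assms incident_in unfolding connected_by_def by blast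

definition acyclic_by :: "'e set \<Rightarrow> bool" where
  "acyclic_by F \<longleftrightarrow> F \<subseteq> E \<and> (\<forall>t\<in>F. \<not> reach G (F - {t}) (tl_end t) (hd_end t))"

lemma spanning_tree_iff: "T \<in> S G \<longleftrightarrow> connected_by G T \<and> acyclic_by T"
  by (auto simp: S_def spanning_tree_def acyclic_by_def)

lemma acyclic_bridge:
  assumes "acyclic_by F" "t \<in> F" "incident G x t"
  shows "\<not> reach G (F - {t}) x (other G x t)"
proof -
  have "x = tl_end t \<or> x = hd_end t" "t \<in> E" using assms(3) by (auto simp: incident_def)
  then show ?thesis using assms reach_sym other_ends unfolding acyclic_by_def by metis
qed

lemma acyclic_subset: "acyclic_by F \<Longrightarrow> F' \<subseteq> F \<Longrightarrow> acyclic_by F'"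
  unfolding acyclic_by_def
  by (meson Diff_mono order_refl reach_mono subset_eq)

text \<open>Deleting an edge \<open>t\<close> splits \<open>A\<close> into what one end still
  reaches and the rest. Both parts are nonempty and no other edge joins them, so the two induction
  bounds together leave one unit for \<open>t\<close>. Arbitrary \<open>A\<close> is allowed because
  the bound is also applied inside vertex subsets.\<close>

lemma acyclic_card_less:
  assumes "finite A" "A \<noteq> {}" "acyclic_by F" "\<And>f. f \<in> F \<Longrightarrow> tl_end f \<in> A \<and> hd_end f \<in> A"
  shows "card F < card A"
proof -
  have "finite F" using assms(3) finite_edges by (auto simp: acyclic_by_def)
  then show ?thesis using assms
  proof (induction "card F" arbitrary: F A rule: less_induct)
    case less
    show ?case
    proof (cases "F = {}")
      case True
      then show ?thesis using less.prems by (simp add: card_gt_0_iff)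
    next
      case False
      then obtain t where t: "t \<in> F" by blast
      let ?x = "tl_end t" and ?y = "hd_end t"
      have tE: "t \<in> E" "F \<subseteq> E" using t less.prems(4) by (auto simp: acyclic_by_def)
      define B where "B = {u\<in>A. reach G (F - {t}) ?x u}"
      define F1 where "F1 = {f\<in>F - {t}. tl_end f \<in> B}"
      define F2 where "F2 = {f\<in>F - {t}. tl_end f \<notin> B}"
      have nr: "\<not> reach G (F - {t}) ?x ?y" using less.prems(4) t by (auto simp: acyclic_by_def)
      have same: "tl_end f \<in> B \<longleftrightarrow> hd_end f \<in> B" if f: "f \<in> F - {t}" for f
      proof -
        have fE: "f \<in> E" using f tE by auto
        have "reach G (F - {t}) (tl_end f) (hd_end f)"
          using reach_edge[OF f incident_ends(1)[OF fE]] other_ends fE by simp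
        then show ?thesis using f less.prems(5) reach_trans reach_sym unfolding B_def by blast
      qed
      have x: "?x \<in> B" using t less.prems(5) reach_refl by (simp add: B_def)
      have y: "?y \<in> A - B" using t less.prems(5) nr by (simp add: B_def)
      have "card F1 < card B"
      proof (rule less.hyps)
        show "card F1 < card F" using t less.prems(1) by (intro psubset_card_mono) (auto simp: F1_def)
        show "acyclic_by F1" using less.prems(4) acyclic_subset by (auto simp: F1_def)
      qed (use less.prems same x in \<open>auto simp: F1_def B_def\<close>)
      moreover have "card F2 < card (A - B)"
      proof (rule less.hyps)
        show "card F2 < card F" using t less.prems(1) by (intro psubset_card_mono) (auto simp: F2_def)
        show "acyclic_by F2" using less.prems(4) acyclic_subset by (auto simp: F2_def)
        show "tl_end f \<in> A - B \<and> hd_end f \<in> A - B" if "f \<in> F2" for f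
          using that same less.prems(5) by (auto simp: F2_def)
      qed (use less.prems y in \<open>auto simp: F2_def\<close>)
      moreover have "card F = Suc (card F1 + card F2)"
      proof -
        have "F - {t} = F1 \<union> F2" "F1 \<inter> F2 = {}" by (auto simp: F1_def F2_def)
        then show ?thesis using less.prems(1) t card.remove
          by (metis card_Un_disjoint finite_Diff finite_Un)
      qed
      moreover have "card A = card B + card (A - B)"
        using less.prems(2) by (metis (no_types, lifting) B_def add_diff_inverse_nat card_Diff_subset card_mono
            finite_Collect_conjI linorder_not_less mem_Collect_eq rev_finite_subset subsetI)
      ultimately show ?thesis by simp
    qed
  qed
qed

text \<open>Some edge leaves \<open>B\<close>, say from \<open>b\<close>; it touches
  \<open>B\<close> but not \<open>B - {b}\<close>, so each vertex taken away costs at least one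
  edge.\<close>

lemma connected_card_ge:
  assumes F: "connected_by G F" "F \<subseteq> E" and "B \<subseteq> V" "B \<noteq> V"
  shows "card B \<le> card {f\<in>F. tl_end f \<in> B \<or> hd_end f \<in> B}"
proof -
  have "finite B" using assms(3) by (rule finite_verts)
  then show ?thesis using assms(3,4)
  proof (induction "card B" arbitrary: B)
    case (Suc n)
    let ?M = "\<lambda>B. {f\<in>F. tl_end f \<in> B \<or> hd_end f \<in> B}"
    have finM: "finite (?M B)" using F finite_subset[of F E] by simp
    obtain u where u: "u \<in> B" using Suc.hyps(2) by fastforce
    obtain w where w: "w \<in> V" "w \<notin> B" using Suc.prems by blast
    have "reach G F u w" using F u w Suc.prems by (auto simp: connected_by_def)
    then obtain b f where f: "f \<in> F" "incident G b f" "b \<in> B" "other G b f \<notin> B"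
      using reach_exit[of F u w B] u w by blast
    have "n = card (B - {b})" using Suc.hyps(2) Suc.prems f by simp
    then have IH: "card (B - {b}) \<le> card (?M (B - {b}))"
      using Suc.prems f w by (intro Suc.hyps(1)) auto
    have "f \<in> ?M B" "f \<notin> ?M (B - {b})"
      using f ends_neq by (auto simp: incident_def other_def split: if_splits)
    then have "?M (B - {b}) \<subset> ?M B" by auto
    then have "card (?M (B - {b})) < card (?M B)" using finM by (intro psubset_card_mono) auto
    then show ?case using IH Suc.hyps(2) Suc.prems f by simp
  qed simp
qed

lemma tree_card: "T \<in> S G \<Longrightarrow> V \<noteq> {} \<Longrightarrow> card T + 1 = card V"
proof -
  assume T: "T \<in> S G" and V: "V \<noteq> {}"
  then have TE: "T \<subseteq> E" by (auto simp: spanning_tree_iff acyclic_by_def)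
  obtain v where v: "v \<in> V" using V by blast
  have "card (V - {v}) \<le> card {f\<in>T. tl_end f \<in> V - {v} \<or> hd_end f \<in> V - {v}}"
    using T TE v by (intro connected_card_ge) (auto simp: spanning_tree_iff)
  also have "\<dots> \<le> card T" using finite_edges[OF TE] by (intro card_mono) auto
  finally have "card V - 1 \<le> card T" using v by simp
  moreover have "card T < card V"
    using T TE V ends_in by (intro acyclic_card_less) (auto simp: spanning_tree_iff)
  ultimately show ?thesis by simp
qed

lemma tree_of_card:
  assumes F: "connected_by G F" "F \<subseteq> E" "card F + 1 = card V"
  shows "F \<in> S G"
  unfolding spanning_tree_iff acyclic_by_def
proof (intro conjI ballI notI)
  fix t assume t: "t \<in> F" and r: "reach G (F - {t}) (tl_end t) (hd_end t)"
  have tE: "t \<in> E" using t F by auto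
  have "connected_by G (F - {t})"
    unfolding connected_by_def
  proof (intro ballI)
    have *: "reach G (F - {t}) (tl_end t) u" if "u \<in> V" for u
      using bridge_sides[OF F(1) incident_ends(1)[OF tE] that] r reach_trans other_ends tE by metis
    show "reach G (F - {t}) u w" if "u \<in> V" "w \<in> V" for u w
      using *[OF that(1)] *[OF that(2)] reach_sym reach_trans by blast
  qed
  moreover have "V - {tl_end t} \<subseteq> V" "V - {tl_end t} \<noteq> V" using ends_in tE by auto
  ultimately have "card (V - {tl_end t}) \<le> card {f\<in>F - {t}. tl_end f \<in> V - {tl_end t} \<or> hd_end f \<in> V - {tl_end t}}"
    using F(2) by (intro connected_card_ge) auto
  also have "\<dots> \<le> card (F - {t})" using finite_edges[OF F(2)] by (intro card_mono) auto
  finally show False using F t tE finite_subset[of F E] ends_in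
    by (metis One_nat_def Suc_n_not_le_n add.commute card.remove card_Diff_singleton diff_Suc_1
        finite_E plus_1_eq_Suc)
qed (use F in auto)

lemma tree_exchange:
  assumes T: "T \<in> S G" and t: "t \<in> T" and f: "f \<in> E - T"
    and sep: "\<not> reach G (T - {t}) (tl_end f) (hd_end f)"
  shows "insert f (T - {t}) \<in> S G"
proof (rule tree_of_card)
  have TE: "T \<subseteq> E" "connected_by G T" using T by (auto simp: spanning_tree_iff acyclic_by_def)
  then show "insert f (T - {t}) \<subseteq> E" using f by auto
  have V: "V \<noteq> {}" using f ends_in by blast
  have "finite T" using finite_edges[OF TE(1)] .
  then have "card (insert f (T - {t})) = card T" using f t
    by (metis Diff_iff card_insert_disjoint card.remove finite_Diff)
  then show "card (insert f (T - {t})) + 1 = card V" using tree_card[OF T V] by simp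
  let ?F = "insert f (T - {t})" and ?a = "tl_end f" and ?b = "hd_end f"
  have tE: "t \<in> E" using t TE by auto
  let ?x = "tl_end t" and ?y = "hd_end t"
  have sides: "reach G (T - {t}) ?x u \<or> reach G (T - {t}) ?y u" if "u \<in> V" for u
    using bridge_sides[OF TE(2) incident_ends(1)[OF tE] that] other_ends tE by simp
  have ab: "reach G ?F ?a ?b"
    using reach_edge[of f ?F ?a] incident_ends f other_ends by auto
  have same: "reach G (T - {t}) u w" if "reach G (T - {t}) z u" "reach G (T - {t}) z w" for u w z
    using reach_trans[OF reach_sym[OF that(1)] that(2)] .
  have *: "reach G ?F ?a u" if u: "u \<in> V" for u
  proof -
    have "?a \<in> V" "?b \<in> V" using ends_in f by auto
    then have "reach G (T - {t}) ?a u \<or> reach G (T - {t}) ?b u"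
      using sides[OF u] sides[of ?a] sides[of ?b] same sep by blast
    then have "reach G ?F ?a u \<or> reach G ?F ?b u" using reach_mono subset_insertI by metis
    then show ?thesis using reach_trans[OF ab] by blast
  qed
  show "connected_by G ?F" unfolding connected_by_def
    using reach_trans[OF reach_sym[OF *] *] by blast
qed

section \<open>Tours of forests\<close>

lemma orb_component:
  assumes "d \<in> darts G" "d' \<in> orb (tour_step G F) d"
  shows "reach G F (fst d) (fst d')"
proof -
  have "reach G F (fst d) (fst ((tour_step G F ^^ n) d))" for n
  proof (induction n)
    case (Suc n)
    obtain u f where uf: "(tour_step G F ^^ n) d = (u, f)" by fastforce
    have "incident G u f" using funpow_in[OF tour_step_bij[of F] assms(1), of n] uf by (simp add: darts_iff)
    then have "reach G F u (fst (tour_step G F (u, f)))"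
      using reach_edge reach_refl by (auto simp: tour_step_def Let_def)
    then show ?case using Suc uf reach_trans by auto
  qed (simp add: reach_refl)
  then show ?thesis using assms by (auto simp: orb_def)
qed

text \<open>Without edges this is transitivity of the rotations. A new forest edge joins two
  components, so by \<open>orb_component\<close> its darts lie on different cycles, and the
  transposition merges these.\<close>

lemma forest_orbits:
  assumes "acyclic_by F"
  shows "reach G F u w \<Longrightarrow> incident G u f \<Longrightarrow> incident G w g \<Longrightarrow> (w, g) \<in> orb (tour_step G F) (u, f)"
proof -
  have "finite F" using assms finite_edges by (auto simp: acyclic_by_def)
  then show "reach G F u w \<Longrightarrow> incident G u f \<Longrightarrow> incident G w g \<Longrightarrow> (w, g) \<in> orb (tour_step G F) (u, f)"
    using assms
  proof (induction F arbitrary: u w f g rule: finite_induct)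
    case empty
    have "w = u" using empty(1) by (induction rule: reach_induct) auto
    moreover have "(tour_step G {} ^^ n) (u, f) = (u, (rot G u ^^ n) f)" for n
      by (induction n) (auto simp: tour_step_notin)
    ultimately show ?case using rot_transitive empty orb_iterate by metis
  next
    case (insert t F)
    have ac: "acyclic_by F" using insert.prems acyclic_subset by blast
    let ?x = "tl_end t" and ?y = "hd_end t"
    have tE: "t \<in> E" using insert.prems by (auto simp: acyclic_by_def)
    have nr: "\<not> reach G F ?x ?y" using insert.prems insert.hyps by (auto simp: acyclic_by_def)
    interpret swapped_perm "darts G" "tour_step G F" "tour_step G (insert t F)" "(?x, t)" "(?y, t)"
      using tour_step_swapped[OF incident_ends(1)[OF tE] insert.hyps(2)] other_ends tE by simp
    have nb: "(?y, t) \<notin> orb (tour_step G F) (?x, t)" using orb_component[OF a] nr by fastforce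
    have *: "(w, g) \<in> orb (tour_step G (insert t F)) (w, f)" if "incident G w f" "incident G w g" for w f g
      using orb_merge(2)[OF nb] insert.IH[OF reach_refl that ac] that by (auto simp: darts_iff)
    have cross: "(other G w t, t) \<in> orb (tour_step G (insert t F)) (w, t)" if w: "incident G w t" for w
    proof -
      have "w = ?x \<or> w = ?y" using w by (auto simp: incident_def)
      moreover have "(?x, t) \<in> orb (tour_step G (insert t F)) (?y, t)"
        using orb_sym[OF fin p' a orb_merge(1)[OF nb]] .
      ultimately show ?thesis using orb_merge(1)[OF nb] other_ends tE by auto
    qed
    show ?case using insert.prems(1) insert.prems(2,3)
    proof (induction arbitrary: g rule: reach_induct)
      case refl
      then show ?case using * by blast
    next
      case (step x h)
      have 1: "(x, h) \<in> orb (tour_step G (insert t F)) (u, f)" using step by blast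
      have inc': "incident G (other G x h) h" using other_incident step by blast
      have "(other G x h, h) \<in> orb (tour_step G (insert t F)) (x, h)"
      proof (cases "h = t")
        case True
        then show ?thesis using cross step by blast
      next
        case False
        then have "reach G F x (other G x h)" using step reach_edge by blast
        then show ?thesis using orb_merge(2)[OF nb] insert.IH[OF _ step(3) inc' ac] step(3)
          by (auto simp: darts_iff)
      qed
      then show ?case using 1 *[OF inc' step.prems(2)] orb_trans by metis
    qed
  qed
qed

lemma tree_single_cycle:
  assumes T: "T \<in> S G" and d: "d \<in> darts G"
  shows "single_cycle (darts G) (tour_step G T) d"
proof unfold_locales
  show "darts G \<subseteq> orb (tour_step G T) d"
  proof
    fix d' assume d': "d' \<in> darts G"
    have "reach G T (fst d) (fst d')"
      using T d d' incident_in by (auto simp: spanning_tree_iff connected_by_def darts_def)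
    then show "d' \<in> orb (tour_step G T) d"
      using forest_orbits[of T "fst d" "fst d'" "snd d" "snd d'"] T d d'
      by (auto simp: spanning_tree_iff darts_def)
  qed
qed (use d in \<open>auto simp: finite_darts tour_step_bij\<close>)

end

section \<open>Changing the starting dart\<close>

context ribbon
begin

abbreviation "tp T d u f \<equiv> pos (tour_step G T) d (u, f)"

abbreviation "fcut d T f \<equiv> eta G (fst d) (snd d) T f"

abbreviation "bd d T \<equiv> bernardi G (fst d) (snd d) T"

lemma bernardi_sum: "bernardi G v e T z = (\<Sum>f\<in>E - T. of_bool (eta G v e T f = z))"
  unfolding bernardi_def by (simp add: of_bool_def sum.If_cases Int_def)

lemma laplacian_edges:
  "laplacian G h u = (\<Sum>f\<in>E. (of_bool (u = tl_end f) - of_bool (u = hd_end f)) * (h (tl_end f) - h (hd_end f)))"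
proof -
  have "laplacian G h u = (\<Sum>f\<in>{f\<in>E. incident G u f}. h u - h (other G u f))"
    unfolding laplacian_def inc_edges_def by (rule sum.cong) (auto simp: incident_def)
  also have "\<dots> = (\<Sum>f\<in>E. if incident G u f then h u - h (other G u f) else 0)"
    by (rule sum.inter_filter) simp
  also have "\<dots> = (\<Sum>f\<in>E. (of_bool (u = tl_end f) - of_bool (u = hd_end f)) * (h (tl_end f) - h (hd_end f)))"
    using ends_neq by (intro sum.cong) (auto simp: incident_def other_def)
  finally show ?thesis .
qed

end

locale tour = ribbon G for G :: "('v,'e) rgraph" +
  fixes T :: "'e set" and d :: "'v \<times> 'e"
  assumes T: "T \<in> S G" and d: "d \<in> darts G"
begin

sublocale c: single_cycle "darts G" "tour_step G T" d
  using tree_single_cycle[OF T d] .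

lemma T_sub: "T \<subseteq> E" and T_conn: "connected_by G T" and T_acyc: "acyclic_by T"
  using T by (auto simp: spanning_tree_iff acyclic_by_def)

lemma finite_T [simp]: "finite T"
  using finite_edges[OF T_sub] .

lemma V_nonempty: "V \<noteq> {}"
  using d incident_in by (fastforce simp: darts_def)

lemma tp_less: "incident G u f \<Longrightarrow> tp T d u f < card (darts G)"
  using c.pos_less by (simp add: darts_iff)

lemma tp_funpow: "incident G u f \<Longrightarrow> (tour_step G T ^^ tp T d u f) d = (u, f)"
  using c.funpow_pos by (simp add: darts_iff)

lemma tp_eqI: "k < card (darts G) \<Longrightarrow> (tour_step G T ^^ k) d = (u, f) \<Longrightarrow> tp T d u f = k"
  by (rule c.pos_eqI)

lemma tp_inj: "incident G u f \<Longrightarrow> incident G w g \<Longrightarrow> tp T d u f = tp T d w g \<Longrightarrow> u = w \<and> f = g"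
  using tp_funpow by (metis prod.inject)

lemma tp_neq_other: "incident G u f \<Longrightarrow> tp T d u f \<noteq> tp T d (other G u f) f"
  using tp_inj other_incident other_neq by metis

lemma dart_at: "incident G (fst ((tour_step G T ^^ k) d)) (snd ((tour_step G T ^^ k) d))"
  using funpow_in[OF tour_step_bij[of T] d, of k] by (simp add: darts_def case_prod_unfold)

lemma first_dart:
  assumes "f \<in> E"
  obtains x where "incident G x f" "tp T d x f < tp T d (other G x f) f"
proof -
  have i: "incident G (tl_end f) f" using incident_ends assms by blast
  then consider "tp T d (tl_end f) f < tp T d (hd_end f) f" | "tp T d (hd_end f) f < tp T d (tl_end f) f"
    using tp_neq_other other_ends assms by (metis linorder_neqE_nat)
  then show thesis
  proof cases
    case 1
    then show thesis using that[OF i] other_ends(1)[OF assms] by simp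
  next
    case 2
    then show thesis using that[OF incident_ends(2)[OF assms]] other_ends(2)[OF assms] by simp
  qed
qed

text \<open>\<open>tour_len\<close> may stop short of the full cycle, so the first of the two darts
  has to be shown to come before it.\<close>

lemma eta_eq:
  assumes f: "f \<in> E - T" and x: "incident G x f" and first: "tp T d x f < tp T d (other G x f) f"
  shows "fcut d T f = x"
proof -
  let ?\<sigma> = "tour_step G T" and ?N = "card (darts G)"
  let ?P = "\<lambda>n. \<forall>t\<in>T. \<forall>x. incident G x t \<longrightarrow> (\<exists>k<n. (?\<sigma> ^^ k) d = (x, t))"
  define L where "L = (LEAST n. ?P n)"
  have L': "tour_len G (fst d) (snd d) T = L" by (simp add: tour_len_def L_def)
  have "?P ?N" using tp_less tp_funpow by blast
  then have L: "?P L" unfolding L_def by (rule LeastI)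
  let ?k = "tp T d x f" and ?l = "tp T d (other G x f) f"
  have lN: "?l < ?N" using tp_less other_incident x by blast
  have at_k: "(?\<sigma> ^^ ?k) d = (x, f)" and at_l: "(?\<sigma> ^^ ?l) d = (other G x f, f)"
    using tp_funpow other_incident x by blast+
  have kL: "?k < L"
  proof (rule ccontr)
    assume kL: "\<not> ?k < L"
    \<comment> \<open>All darts of tree edges occur before \<open>L\<close>. From then on the tour
      only rotates at one vertex, so it could not get from \<open>x\<close> to the dart of
      \<open>f\<close> at the other end.\<close>
    have notT: "snd ((?\<sigma> ^^ j) d) \<notin> T" if j: "L \<le> j" "j < ?N" for j
    proof
      assume "snd ((?\<sigma> ^^ j) d) \<in> T"
      then obtain k where k: "k < L" "(?\<sigma> ^^ k) d = (?\<sigma> ^^ j) d"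
        using L dart_at[of j] by (metis prod.collapse)
      then show False using c.pos_funpow j by (metis le_less_trans less_imp_le not_less)
    qed
    have "?k + i < ?N \<Longrightarrow> fst ((?\<sigma> ^^ (?k + i)) d) = x" for i
    proof (induction i)
      case 0
      show ?case using at_k by simp
    next
      case (Suc i)
      obtain u g where ug: "(?\<sigma> ^^ (?k + i)) d = (u, g)" by fastforce
      then have "g \<notin> T" using notT[of "?k + i"] Suc kL by simp
      then show ?case using Suc ug by (simp add: tour_step_notin)
    qed
    from this[of "?l - ?k"] show False using first lN at_l other_neq[OF x] by simp
  qed
  have nofirst: "snd ((?\<sigma> ^^ j) d) \<noteq> f" if "j < ?k" for j
  proof
    assume s: "snd ((?\<sigma> ^^ j) d) = f"
    let ?u = "fst ((?\<sigma> ^^ j) d)"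
    have eq: "(?\<sigma> ^^ j) d = (?u, f)" using s by (metis prod.collapse)
    have "j < ?N" using that first lN by simp
    then have "tp T d ?u f = j" using eq by (rule tp_eqI)
    moreover have "?u = x \<or> ?u = other G x f" using dart_at[of j] s incident_cases[OF x] by simp
    ultimately show False using that first by auto
  qed
  show ?thesis unfolding eta_def L'
  proof (rule the_equality)
    show "incident G x f \<and> (\<exists>k<L. (?\<sigma> ^^ k) (fst d, snd d) = (x, f) \<and> (\<forall>j<k. snd ((?\<sigma> ^^ j) (fst d, snd d)) \<noteq> f))"
      using x kL at_k nofirst by auto
    fix x' assume "incident G x' f \<and> (\<exists>k<L. (?\<sigma> ^^ k) (fst d, snd d) = (x', f) \<and> (\<forall>j<k. snd ((?\<sigma> ^^ j) (fst d, snd d)) \<noteq> f))"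
    then obtain k where k: "(?\<sigma> ^^ k) d = (x', f)" "\<forall>j<k. snd ((?\<sigma> ^^ j) d) \<noteq> f" by auto
    have "k = ?k" using k nofirst[of k] at_k by (metis linorder_neqE_nat snd_conv)
    then show "x' = x" using k at_k by simp
  qed
qed

lemma eta_incident: "f \<in> E - T \<Longrightarrow> incident G (fcut d T f) f"
  using first_dart eta_eq by (metis DiffD1)

text \<open>Only the two passages of \<open>t\<close> change the side of \<open>T - {t}\<close>, so
  the stay beyond \<open>t\<close> is one interval. It excludes the dart at \<open>x\<close>,
  examined before the crossing, and includes the returning dart, examined while still beyond
  \<open>t\<close>.\<close>

lemma segment:
  assumes t: "t \<in> T" "incident G x t" and first: "tp T d x t < tp T d (other G x t) t"
    and ug: "incident G u g"
  shows "reach G (T - {t}) (other G x t) u \<longleftrightarrow> tp T d x t < tp T d u g \<and> tp T d u g \<le> tp T d (other G x t) t"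
proof -
  let ?\<sigma> = "tour_step G T" and ?N = "card (darts G)"
  let ?y = "other G x t"
  define at where "at j = fst ((?\<sigma> ^^ j) d)" for j
  define B where "B = {u. reach G (T - {t}) ?y u}"
  let ?k = "tp T d x t" and ?l = "tp T d ?y t"
  have y: "incident G ?y t" using t other_incident by blast
  have lN: "?l < ?N" using tp_less[OF y] .
  have xB: "x \<notin> B" using acyclic_bridge[OF T_acyc t] reach_sym by (auto simp: B_def)
  have yB: "?y \<in> B" by (simp add: B_def reach_refl)
  have same: "at (Suc j) \<in> B \<longleftrightarrow> at j \<in> B" if j: "j \<noteq> ?k" "j \<noteq> ?l" "j < ?N" for j
  proof -
    obtain w h where wh: "(?\<sigma> ^^ j) d = (w, h)" by fastforce
    have i: "incident G w h" using dart_at[of j] wh by simp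
    have "tp T d w h = j" using tp_eqI[OF j(3) wh] .
    then have ht: "h \<noteq> t" using j i incident_cases[OF t(2)] by blast
    show ?thesis
    proof (cases "h \<in> T")
      case True
      then have "reach G (T - {t}) w (other G w h)" using reach_edge ht i by simp
      moreover from this have "reach G (T - {t}) (other G w h) w" by (rule reach_sym)
      moreover have "at (Suc j) = other G w h" "at j = w" using wh True by (simp_all add: at_def tour_step_in)
      ultimately show ?thesis using reach_trans unfolding B_def by auto
    next
      case False
      then show ?thesis using wh by (simp add: at_def tour_step_notin)
    qed
  qed
  have next_k: "at (Suc ?k) = ?y" using tp_funpow[OF t(2)] t(1) by (simp add: at_def tour_step_in)
  have next_l: "at (Suc ?l) = x"
    using tp_funpow[OF y] t(1) other_other[OF t(2)] by (simp add: at_def tour_step_in)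
  have 1: "at j \<in> B" if "?k < j" "j \<le> ?l" for j
    using that
  proof (induction j)
    case (Suc j)
    show ?case
    proof (cases "j = ?k")
      case True
      then show ?thesis using next_k yB by simp
    next
      case False
      then show ?thesis using Suc same[of j] lN by simp
    qed
  qed simp
  have 2: "at j \<notin> B" if "?l < j" "j < ?N" for j
    using that
  proof (induction j)
    case (Suc j)
    show ?case
    proof (cases "j = ?l")
      case True
      then show ?thesis using next_l xB by simp
    next
      case False
      then show ?thesis using Suc same[of j] first by simp
    qed
  qed simp
  have 3: "at j \<notin> B" if "j \<le> ?k" for j
    using that
  proof (induction rule: inc_induct)
    case base
    show ?case using xB tp_funpow[OF t(2)] by (simp add: at_def)
  next
    case (step n)
    then show ?case using same[of n] first lN by simp
  qed
  have "u = at (tp T d u g)" using tp_funpow[OF ug] by (simp add: at_def)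
  then have "u \<in> B \<longleftrightarrow> ?k < tp T d u g \<and> tp T d u g \<le> ?l"
    using 1 2 3 tp_less[OF ug] by (metis not_less)
  then show ?thesis by (simp add: B_def)
qed

text \<open>The order of the two darts of \<open>f\<close> is reversed exactly when the new start
  skips one of them, which must be the earlier one.\<close>

lemma eta_rotate:
  assumes f: "f \<in> E - T" and x: "incident G x f" and first: "tp T d x f < tp T d (other G x f) f"
    and m: "m \<le> card (darts G)"
  shows "fcut ((tour_step G T ^^ m) d) T f =
    (if tp T d x f < m \<and> m \<le> tp T d (other G x f) f then other G x f else x)"
proof -
  let ?d = "(tour_step G T ^^ m) d"
  interpret r: tour G T ?d
    using T funpow_in[OF tour_step_bij d] by unfold_locales
  have y: "incident G (other G x f) f" using other_incident[OF x] .
  have rot: "tp T ?d u f = (if m \<le> tp T d u f then tp T d u f - m else tp T d u f + card (darts G) - m)"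
    if "incident G u f" for u
    using c.pos_rotate[OF m] that by (simp add: darts_iff)
  show ?thesis
  proof (cases "tp T d x f < m \<and> m \<le> tp T d (other G x f) f")
    case True
    then have "tp T ?d (other G x f) f < tp T ?d x f"
      using rot[OF x] rot[OF y] tp_less[OF y] first by auto
    then have "fcut ?d T f = other G x f" using r.eta_eq[OF f y] other_other[OF x] by simp
    then show ?thesis unfolding if_P[OF True] .
  next
    case False
    then have "tp T ?d x f < tp T ?d (other G x f) f"
      using rot[OF x] rot[OF y] first tp_less[OF x] tp_less[OF y] m by auto
    then show ?thesis unfolding if_not_P[OF False] by (rule r.eta_eq[OF f x])
  qed
qed

lemma bernardi_rot:
  assumes ve: "d = (v, e)"
  shows "\<exists>h. \<forall>z. bd (v, rot G v e) T z - bd (v, e) T z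
    = of_bool (z = other G v e) - of_bool (z = v) + laplacian G h z"
proof -
  let ?w = "other G v e" and ?N = "card (darts G)"
  let ?t = "\<lambda>h z f. (of_bool (z = tl_end f) - of_bool (z = hd_end f)) * (h (tl_end f) - h (hd_end f)) :: int"
  have v: "incident G v e" using d ve by (simp add: darts_iff)
  have w: "incident G ?w e" using other_incident[OF v] .
  have eE: "e \<in> E" using incident_in(2)[OF v] .
  have p0: "tp T d v e = 0" using c.pos_self ve by simp
  have p1: "0 < tp T d ?w e" using tp_neq_other[OF v] p0 by simp
  have diff: "bd (v, rot G v e) T z - bd (v, e) T z
      = (\<Sum>f\<in>E - T. of_bool (fcut (v, rot G v e) T f = z) - of_bool (fcut (v, e) T f = z))" for z
    by (simp add: bernardi_sum sum_subtractf)
  show ?thesis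
  proof (cases "e \<in> T")
    case False
    have N: "1 \<le> ?N" using tp_less[OF w] by simp
    have step: "(tour_step G T ^^ 1) d = (v, rot G v e)" using ve False by (simp add: tour_step_notin)
    have "of_bool (fcut (v, rot G v e) T f = z) - of_bool (fcut (v, e) T f = z)
      = (if f = e then of_bool (z = ?w) - of_bool (z = v) else 0 :: int)" if f: "f \<in> E - T" for f z
    proof -
      have "f \<in> E" using f by simp
      then obtain x where x: "incident G x f" "tp T d x f < tp T d (other G x f) f"
        by (rule first_dart)
      have "tp T d x f < 1 \<longleftrightarrow> x = v \<and> f = e"
        using tp_inj[OF x(1) v] p0 by auto
      moreover have "f = e \<Longrightarrow> x = v" using x p0 incident_cases[OF v, of x] other_other[OF v] by auto
      ultimately show ?thesis using eta_rotate[OF f x N, unfolded step] eta_eq[OF f x] x(2) ve p0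
        by (cases "f = e") auto
    qed
    then have "bd (v, rot G v e) T z - bd (v, e) T z = of_bool (z = ?w) - of_bool (z = v)" for z
      unfolding diff using eE False by simp
    then show ?thesis by (intro exI[of _ "\<lambda>_. 0"]) (simp add: laplacian_def)
  next
    case True
    \<comment> \<open>The tour crosses \<open>e\<close>, goes round everything beyond it and crosses
      back from \<open>?w\<close>; the dart examined next is \<open>(v, rot G v e)\<close>.\<close>
    let ?m = "Suc (tp T d ?w e)"
    \<comment> \<open>Each non-tree edge between the two sides moves its chip out of the side beyond
      \<open>e\<close>, as if that side fired. Firing would also send a chip along \<open>e\<close>
      from \<open>?w\<close> to \<open>v\<close>, and \<open>(?w) - (v)\<close> corrects for
      this.\<close>
    define h where "h u = - (of_bool (reach G (T - {e}) ?w u) :: int)" for u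
    have N: "?m \<le> ?N" using tp_less[OF w] by simp
    have step: "(tour_step G T ^^ ?m) d = (v, rot G v e)"
      using tp_funpow[OF w] True other_other[OF v] by (simp add: tour_step_in)
    have seg: "reach G (T - {e}) ?w u \<longleftrightarrow> 0 < tp T d u g \<and> tp T d u g \<le> tp T d ?w e"
      if "incident G u g" for u g
      using segment[OF True v _ that] p0 p1 by simp
    have pointwise: "of_bool (fcut (v, rot G v e) T f = z) - of_bool (fcut (v, e) T f = z) = ?t h z f"
      if f: "f \<in> E - T" for f z
    proof -
      have fE: "f \<in> E" using f by simp
      then obtain x where x: "incident G x f" "tp T d x f < tp T d (other G x f) f"
        by (rule first_dart)
      let ?y = "other G x f"
      have y: "incident G ?y f" using other_incident[OF x(1)] .
      \<comment> \<open>Position 0 counts as skipped in \<open>eta_rotate\<close> but not as beyond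
        \<open>e\<close> in \<open>seg\<close>; it belongs to the tree edge
        \<open>e\<close>.\<close>
      have "tp T d x f \<noteq> 0" using tp_inj[OF x(1) v] p0 f True by auto
      then have hx: "h x = - of_bool (tp T d x f < ?m)" and hy: "h ?y = - of_bool (tp T d ?y f < ?m)"
        using seg[OF x(1)] seg[OF y] x(2) by (auto simp: h_def)
      have *: "of_bool (fcut (v, rot G v e) T f = z) - of_bool (fcut (v, e) T f = z)
        = (of_bool (z = x) - of_bool (z = ?y)) * (h x - h ?y)"
        using eta_rotate[OF f x N, unfolded step] eta_eq[OF f x] x(2) ve hx hy by auto
      have "x = tl_end f \<and> ?y = hd_end f \<or> x = hd_end f \<and> ?y = tl_end f"
        using x(1) other_ends[OF fE] by (auto simp: incident_def)
      then show ?thesis using * by (auto simp: algebra_simps)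
    qed
    have zero: "?t h z f = 0" if f: "f \<in> T - {e}" for f z
    proof -
      have fE: "f \<in> E" using f T_sub by auto
      have "reach G (T - {e}) (tl_end f) (hd_end f)"
        using reach_edge[OF f incident_ends(1)[OF fE]] other_ends[OF fE] by simp
      then have "reach G (T - {e}) ?w (tl_end f) \<longleftrightarrow> reach G (T - {e}) ?w (hd_end f)"
        using reach_trans[of "T - {e}" ?w] reach_sym[of "T - {e}"] by blast
      then have "h (tl_end f) = h (hd_end f)" by (simp add: h_def)
      then show ?thesis by simp
    qed
    have at_e: "?t h z e = of_bool (z = v) - of_bool (z = ?w)" for z
    proof -
      have "h v = 0" using acyclic_bridge[OF T_acyc True v] reach_sym by (auto simp: h_def)
      moreover have "h ?w = -1" by (simp add: h_def reach_refl)
      moreover have "v = tl_end e \<and> ?w = hd_end e \<or> v = hd_end e \<and> ?w = tl_end e"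
        using v other_ends[OF eE] by (auto simp: incident_def)
      ultimately show ?thesis by auto
    qed
    have "laplacian G h z = (\<Sum>f\<in>E - T. ?t h z f) + (of_bool (z = v) - of_bool (z = ?w))" for z
    proof -
      have "laplacian G h z = (\<Sum>f\<in>E - T. ?t h z f) + (\<Sum>f\<in>T. ?t h z f)"
        unfolding laplacian_edges using sum.subset_diff[OF T_sub] by simp
      also have "(\<Sum>f\<in>T. ?t h z f) = ?t h z e + (\<Sum>f\<in>T - {e}. ?t h z f)"
        using True by (intro sum.remove) auto
      also have "(\<Sum>f\<in>T - {e}. ?t h z f) = 0" using zero by (intro sum.neutral) blast
      finally show ?thesis using at_e by simp
    qed
    then have "bd (v, rot G v e) T z - bd (v, e) T z
        = of_bool (z = ?w) - of_bool (z = v) + laplacian G h z" for z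
      unfolding diff using pointwise by simp
    then show ?thesis by blast
  qed
qed

end

section \<open>Planarity and interleaving edges\<close>

context ribbon
begin

lemma card_orbits_Un_le:
  assumes "F \<union> Y \<subseteq> E" "F \<inter> Y = {}"
  shows "card (orbits (darts G) (tour_step G (F \<union> Y))) \<le> card (orbits (darts G) (tour_step G F)) + card Y"
proof -
  have "finite Y" using assms finite_edges by blast
  then show ?thesis using assms
  proof (induction Y rule: finite_induct)
    case (insert t Y)
    have tE: "t \<in> E" "t \<notin> F \<union> Y" using insert by auto
    interpret swapped_perm "darts G" "tour_step G (F \<union> Y)" "tour_step G (insert t (F \<union> Y))"
        "(tl_end t, t)" "(other G (tl_end t) t, t)"
      using tour_step_swapped[OF incident_ends(1)] tE by blast
    have "card (orbits (darts G) (tour_step G (insert t (F \<union> Y)))) \<le> card (orbits (darts G) (tour_step G (F \<union> Y))) + 1"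
      by (rule card_orbits_le)
    also have "\<dots> \<le> card (orbits (darts G) (tour_step G F)) + card (insert t Y)"
      using insert by simp
    finally show ?case by simp
  qed simp
qed

end

locale planar_tour = tour +
  assumes planar: "planar G"
begin

lemma no_crossing_half:
  assumes e: "e \<in> E - T" "incident G v e" and f: "f \<in> E - T" "incident G x f" and "f \<noteq> e"
    and x_in: "tp T d v e < tp T d x f" "tp T d x f \<le> tp T d (other G v e) e"
  shows "tp T d v e < tp T d (other G x f) f \<and> tp T d (other G x f) f \<le> tp T d (other G v e) e"
proof (rule ccontr)
  let ?w = "other G v e" and ?y = "other G x f"
  let ?c = "\<lambda>F. card (orbits (darts G) (tour_step G F))"
  \<comment> \<open>Once \<open>e\<close> is crossed, the last dart \<open>(?w, e)\<close> of this
    interval is sent back to its first, so \<open>I\<close> is closed under the new step. The darts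
    of \<open>f\<close> then lie on different cycles, and crossing \<open>f\<close> too creates no
    further cycle.\<close>
  define I where "I = {z \<in> darts G. tp T d v e < pos (tour_step G T) d z \<and> pos (tour_step G T) d z \<le> tp T d ?w e}"
  assume "\<not> ?thesis"
  then have yI: "(?y, f) \<notin> I" by (simp add: I_def)
  have xI: "(x, f) \<in> I" using x_in f by (simp add: I_def darts_iff)
  have w: "incident G ?w e" using other_incident e by blast
  have y: "incident G ?y f" using other_incident f by blast
  interpret e: swapped_perm "darts G" "tour_step G T" "tour_step G (insert e T)" "(v, e)" "(?w, e)"
    using tour_step_swapped e by blast
  interpret f: swapped_perm "darts G" "tour_step G (insert e T)" "tour_step G (insert f (insert e T))" "(x, f)" "(?y, f)"
    using tour_step_swapped[of x f "insert e T"] f \<open>f \<noteq> e\<close> by blast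
  have step_I: "tour_step G (insert e T) z \<in> I" if z: "z \<in> I" for z
  proof -
    have zd: "z \<in> darts G" using z by (simp add: I_def)
    have wN: "tp T d ?w e < card (darts G)" using tp_less[OF w] .
    show ?thesis
    proof (cases "z = (?w, e)")
      case True
      have lt: "tp T d v e < tp T d ?w e" using x_in by simp
      have "tour_step G (insert e T) z = tour_step G T (v, e)" using True e.swap(2) by simp
      moreover have "pos (tour_step G T) d (tour_step G T (v, e)) = tp T d v e + 1"
        using lt wN by (intro c.pos_step) (auto simp: darts_iff e)
      moreover have "tour_step G T (v, e) \<in> darts G"
        using bij_betw_apply[OF tour_step_bij] e by (simp add: darts_iff)
      ultimately show ?thesis using lt by (simp add: I_def)
    next
      case False
      have "z \<noteq> (v, e)" using z by (auto simp: I_def)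
      then have eq: "tour_step G (insert e T) z = tour_step G T z" using e.swap(3) zd False by blast
      have "pos (tour_step G T) d z \<noteq> tp T d ?w e"
        using c.pos_inj[OF zd] w False by (auto simp: darts_iff)
      then have lt: "pos (tour_step G T) d z < tp T d ?w e" using z by (simp add: I_def)
      then have "pos (tour_step G T) d (tour_step G T z) = pos (tour_step G T) d z + 1"
        using wN by (intro c.pos_step zd) simp
      moreover have "tour_step G T z \<in> darts G" using bij_betw_apply[OF tour_step_bij zd] .
      ultimately show ?thesis using lt z eq by (simp add: I_def)
    qed
  qed
  have "(tour_step G (insert e T) ^^ n) (x, f) \<in> I" for n
    by (induction n) (use xI step_I in auto)
  then have "orb (tour_step G (insert e T)) (x, f) \<subseteq> I" by (auto simp: orb_def)
  then have "orb (tour_step G (insert e T)) (x, f) \<noteq> orb (tour_step G (insert e T)) (?y, f)"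
    using yI orb_self[of "(?y, f)"] by blast
  then have "?c (insert f (insert e T)) \<le> ?c (insert e T)" by (rule f.card_orbits_merge_le)
  also have "\<dots> \<le> ?c T + 1" by (rule e.card_orbits_le)
  also have "?c T = 1"
  proof -
    have "orb (tour_step G T) z = orb (tour_step G T) d" if "z \<in> darts G" for z
      by (rule orb_eq[OF finite_darts tour_step_bij d subsetD[OF c.cyc that]])
    then have "orbits (darts G) (tour_step G T) = (\<lambda>_. orb (tour_step G T) d) ` darts G"
      unfolding orbits_def by (intro image_cong) simp_all
    also have "\<dots> = {orb (tour_step G T) d}" using d by blast
    finally have "orbits (darts G) (tour_step G T) = {orb (tour_step G T) d}" .
    then show ?thesis by simp
  qed
  finally have 2: "?c (insert f (insert e T)) \<le> 2" by simp
  \<comment> \<open>At most two cycles so far and at most one more for each of the remaining g - 2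
    edges give at most g faces, while genus 0 demands g + 1.\<close>
  let ?Y = "E - insert f (insert e T)"
  have sub: "insert f (insert e T) \<subseteq> E" using e f T_sub by auto
  have "?c (insert f (insert e T) \<union> ?Y) \<le> ?c (insert f (insert e T)) + card ?Y"
    using sub by (intro card_orbits_Un_le) auto
  also have "insert f (insert e T) \<union> ?Y = E" using sub by auto
  finally have "card (faces G) \<le> 2 + card ?Y" using 2 by (simp add: faces_orbits)
  moreover have "card ?Y + (card T + 2) = card E"
  proof -
    have "card (insert f (insert e T)) = card T + 2" using e f \<open>f \<noteq> e\<close> by simp
    moreover have "card (insert f (insert e T)) \<le> card E" using sub by (intro card_mono) auto
    ultimately show ?thesis using card_Diff_subset[OF finite_edges[OF sub] sub] by simp
  qed
  moreover have "card T + 1 = card V" using tree_card[OF T V_nonempty] .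
  ultimately show False using planar by (simp add: planar_def)
qed

lemma no_crossing:
  assumes e: "e \<in> E - T" "incident G v e" and f: "f \<in> E - T" "incident G x f" and "f \<noteq> e"
  shows "tp T d v e < tp T d x f \<and> tp T d x f \<le> tp T d (other G v e) e \<longleftrightarrow>
    tp T d v e < tp T d (other G x f) f \<and> tp T d (other G x f) f \<le> tp T d (other G v e) e"
  using no_crossing_half[OF assms] no_crossing_half[OF e f(1) other_incident[OF f(2)] \<open>f \<noteq> e\<close>]
    other_other[OF f(2)] by auto

text \<open>If \<open>e\<close> is in \<open>T\<close>, the face step is a tour step that skips only
  a dart of a tree edge. Otherwise it jumps just past the second dart of \<open>e\<close>: both
  darts of \<open>e\<close> are skipped, and any other non-tree edge has both or none skipped
  because it does not interleave with \<open>e\<close>.\<close>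

lemma bernardi_face:
  assumes ve: "d = (v, e)"
  shows "bd (face_perm G (v, e)) T = bd (v, e) T"
proof -
  let ?w = "other G v e" and ?N = "card (darts G)"
  have v: "incident G v e" using d ve by (simp add: darts_iff)
  have w: "incident G ?w e" using other_incident[OF v] .
  have eE: "e \<in> E" using incident_in(2)[OF v] .
  have p0: "tp T d v e = 0" using c.pos_self ve by simp
  define m where "m = (if e \<in> T then 1 else Suc (tp T d ?w e))"
  have N: "m \<le> ?N" using tp_less[OF w] by (auto simp: m_def)
  have step: "(tour_step G T ^^ m) d = face_perm G (v, e)"
    using tp_funpow[OF w] ve by (auto simp: m_def face_perm_def Let_def tour_step_in tour_step_notin)
  have "fcut (face_perm G (v, e)) T f = fcut (v, e) T f" if f: "f \<in> E - T" for f
  proof -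
    have fE: "f \<in> E" using f by simp
    then obtain x where x: "incident G x f" "tp T d x f < tp T d (other G x f) f"
      by (rule first_dart)
    have "\<not> (tp T d x f < m \<and> m \<le> tp T d (other G x f) f)"
    proof
      assume a: "tp T d x f < m \<and> m \<le> tp T d (other G x f) f"
      show False
      proof (cases "f = e")
        case True
        then have "tp T d (other G x f) f \<le> tp T d ?w e"
          using incident_cases[OF v, of "other G x f"] other_incident[OF x(1)] p0 by auto
        then show False using a f True by (simp add: m_def)
      next
        case False
        then have x0: "tp T d x f \<noteq> 0" using tp_inj[OF x(1) v] p0 by auto
        then have "e \<notin> T" using a by (auto simp: m_def split: if_splits)
        then show False using no_crossing[of e v f x] eE v f x False p0 x0 a by (simp add: m_def)
      qed
    qed
    then show ?thesis
      using eta_rotate[OF f x N, unfolded step] eta_eq[OF f x] ve by (metis (mono_tags, lifting))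
  qed
  then show ?thesis by (simp add: bernardi_sum fun_eq_iff)
qed

end

section \<open>Independence of the starting dart up to a common divisor\<close>

context ribbon
begin

text \<open>Rotations exhaust the darts at a vertex and a face step crosses an edge, so
  connectedness of the graph is enough.\<close>

lemma darts_induct [consumes 2, case_names start rot face]:
  assumes d: "d \<in> darts G" and d': "d' \<in> darts G" and "P d"
    and rot: "\<And>u f. incident G u f \<Longrightarrow> P (u, f) \<Longrightarrow> P (u, rot G u f)"
    and face: "\<And>u f. incident G u f \<Longrightarrow> P (u, f) \<Longrightarrow> P (face_perm G (u, f))"
  shows "P d'"
proof -
  have around: "P (u, g)" if f: "incident G u f" and g: "incident G u g" and "P (u, f)" for u f g
  proof -
    obtain n where n: "(rot G u ^^ n) f = g" using rot_transitive f g by blast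
    have "incident G u ((rot G u ^^ n) f) \<and> P (u, (rot G u ^^ n) f)" for n
      by (induction n) (use that rot rot_incident in auto)
    then show ?thesis using n by blast
  qed
  obtain u f where uf: "d = (u, f)" "incident G u f" using d by (auto simp: darts_def)
  obtain w g where wg: "d' = (w, g)" "incident G w g" using d' by (auto simp: darts_def)
  have "reach G E u w" using connected uf(2) wg(2) incident_in by (auto simp: connected_by_def)
  then have "\<forall>g. incident G w g \<longrightarrow> P (w, g)"
  proof (induction rule: reach_induct)
    case refl
    show ?case using around uf \<open>P d\<close> by blast
  next
    case (step x h)
    let ?y = "other G x h"
    have h: "incident G x h" "P (x, h)" using step by auto
    have "P (?y, rot G ?y h)" using face[OF h] by (simp add: face_perm_def Let_def)
    then show ?case using around rot_incident other_incident h(1) by blast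
  qed
  then show ?thesis using wg by blast
qed

lemma laplacian_add: "laplacian G (\<lambda>u. h u + h' u) z = laplacian G h z + laplacian G h' z"
  unfolding laplacian_edges by (simp add: sum.distrib[symmetric] algebra_simps)

lemma laplacian_minus: "laplacian G (\<lambda>u. - h u) z = - laplacian G h z"
  unfolding laplacian_edges by (simp add: sum_negf[symmetric] algebra_simps)

text \<open>The order of quantifiers is the point: \<open>c\<close> is chosen before the tree, so it
  cancels when a tree is compared with its image. Rotation contributes a divisor that depends on the
  dart alone, a face step contributes nothing.\<close>

lemma planar_start_independent:
  assumes "planar G" "d \<in> darts G" "d' \<in> darts G"
  shows "\<exists>c. \<forall>T\<in>S G. \<exists>h. \<forall>z. bd d' T z - bd d T z = c z + laplacian G h z"
    (is "?P d'")
proof (rule darts_induct[of d d' ?P])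
  have "\<forall>z. bd d T z - bd d T z = 0 + laplacian G (\<lambda>_. 0) z" for T
    by (simp add: laplacian_def)
  then show "?P d" by (intro exI[of _ "\<lambda>_. 0"] ballI exI[of _ "\<lambda>_. 0"])
next
  fix u f assume uf: "incident G u f" and P: "?P (u, f)"
  obtain c where c: "\<forall>T\<in>S G. \<exists>h. \<forall>z. bd (u, f) T z - bd d T z = c z + laplacian G h z"
    using P by blast
  show "?P (u, rot G u f)"
  proof (rule exI[of _ "\<lambda>z. c z + (of_bool (z = other G u f) - of_bool (z = u))"], rule ballI)
    fix T assume T: "T \<in> S G"
    interpret tour G T "(u, f)" using T uf by unfold_locales (auto simp: darts_iff)
    obtain h where h: "\<forall>z. bd (u, f) T z - bd d T z = c z + laplacian G h z" using c T by blast
    obtain h' where h': "\<forall>z. bd (u, rot G u f) T z - bd (u, f) T z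
      = of_bool (z = other G u f) - of_bool (z = u) + laplacian G h' z" using bernardi_rot by blast
    show "\<exists>h. \<forall>z. bd (u, rot G u f) T z - bd d T z
      = c z + (of_bool (z = other G u f) - of_bool (z = u)) + laplacian G h z"
    proof (intro exI[of _ "\<lambda>u. h u + h' u"] allI)
      fix z show "bd (u, rot G u f) T z - bd d T z
        = c z + (of_bool (z = other G u f) - of_bool (z = u)) + laplacian G (\<lambda>u. h u + h' u) z"
        unfolding laplacian_add using h[rule_format, of z] h'[rule_format, of z] by linarith
    qed
  qed
next
  fix u f assume uf: "incident G u f" and P: "?P (u, f)"
  have "bd (face_perm G (u, f)) T = bd (u, f) T" if T: "T \<in> S G" for T
  proof -
    interpret planar_tour G T "(u, f)"
      using T uf assms(1) by unfold_locales (auto simp: darts_iff)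
    show ?thesis using bernardi_face by blast
  qed
  then show "?P (face_perm G (u, f))" using P by simp
qed (use assms in auto)

end

section \<open>Break divisors and injectivity of the Bernardi map\<close>

context ribbon
begin

definition ins :: "'e set \<Rightarrow> 'v set \<Rightarrow> 'e set" where
  "ins H A = {f\<in>H. tl_end f \<in> A \<and> hd_end f \<in> A}"

definition cut :: "'e set \<Rightarrow> 'v set \<Rightarrow> 'e set" where
  "cut H A = {f\<in>H. (tl_end f \<in> A) \<noteq> (hd_end f \<in> A)}"

text \<open>The lower bound is the genus that the subgraph induced on \<open>A\<close> has if it is
  connected. The edge set is a parameter because the greedy tour deletes edges while the vertices
  stay.\<close>

definition feasible :: "'e set \<Rightarrow> ('v \<Rightarrow> int) \<Rightarrow> bool" where
  "feasible H D \<longleftrightarrow>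
     (\<forall>A. A \<subseteq> V \<longrightarrow> A \<noteq> {} \<longrightarrow> int (card (ins H A)) - int (card A) + 1 \<le> sum D A) \<and>
     sum D V = int (card H) - int (card V) + 1"

lemma feasible_lower:
  "feasible H D \<Longrightarrow> A \<subseteq> V \<Longrightarrow> A \<noteq> {} \<Longrightarrow> int (card (ins H A)) - int (card A) + 1 \<le> sum D A"
  and feasible_total: "feasible H D \<Longrightarrow> sum D V = int (card H) - int (card V) + 1"
  by (auto simp: feasible_def)

lemma card_ins_cut:
  assumes "H \<subseteq> E"
  shows "card H = card (ins H A) + card (ins H (V - A)) + card (cut H A)"
proof -
  have fin: "finite H" using finite_edges[OF assms] .
  have H: "H = ins H A \<union> ins H (V - A) \<union> cut H A"
    using assms ends_in by (auto simp: ins_def cut_def)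
  have "card (ins H A \<union> ins H (V - A) \<union> cut H A) = card (ins H A) + card (ins H (V - A)) + card (cut H A)"
    using fin by (subst card_Un_disjoint; (subst card_Un_disjoint)?) (auto simp: ins_def cut_def)
  then show ?thesis using H by simp
qed

lemma card_ins_touch:
  assumes "H \<subseteq> E"
  shows "card {f\<in>H. tl_end f \<in> A \<or> hd_end f \<in> A} = card (ins H A) + card (cut H A)"
proof -
  have "{f\<in>H. tl_end f \<in> A \<or> hd_end f \<in> A} = ins H A \<union> cut H A" by (auto simp: ins_def cut_def)
  moreover have "ins H A \<inter> cut H A = {}" by (auto simp: ins_def cut_def)
  ultimately show ?thesis using finite_edges[OF assms] by (simp add: card_Un_disjoint ins_def cut_def)
qed

lemma sum_split_V: "A \<subseteq> V \<Longrightarrow> sum (D :: 'v \<Rightarrow> int) V = sum D A + sum D (V - A)"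
  using sum.subset_diff[of A V D] by (simp add: add.commute)

lemma card_split_V: "A \<subseteq> V \<Longrightarrow> card V = card A + card (V - A)"
  using card_Diff_subset[of A V] finite_verts card_mono[of V A] by simp

text \<open>The total is fixed, so the lower bound for \<open>V - A\<close> is an upper bound for
  \<open>A\<close>.\<close>

lemma feasible_upper:
  assumes H: "H \<subseteq> E" and D: "feasible H D" and A: "A \<subseteq> V" "A \<noteq> V"
  shows "sum D A \<le> int (card (ins H A)) + int (card (cut H A)) - int (card A)"
  using feasible_lower[OF D, of "V - A"] feasible_total[OF D] card_ins_cut[OF H, of A]
    sum_split_V[OF A(1), of D] card_split_V[OF A(1)] A by auto

lemma sum_of_bool_fibers:
  assumes "finite F" "finite A"
  shows "(\<Sum>z\<in>A. \<Sum>f\<in>F. of_bool (g f = z)) = int (card {f\<in>F. g f \<in> A})"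
proof -
  have "(\<Sum>z\<in>A. \<Sum>f\<in>F. of_bool (g f = z)) = (\<Sum>f\<in>F. \<Sum>z\<in>A. of_bool (g f = z))"
    by (rule sum.swap)
  also have "\<dots> = (\<Sum>f\<in>F. of_bool (g f \<in> A) :: int)"
    using assms(2) by (intro sum.cong refl) (simp add: of_bool_def)
  also have "\<dots> = int (card {f\<in>F. g f \<in> A})"
    using assms(1) by (simp add: of_bool_def sum.If_cases Int_def)
  finally show ?thesis .
qed

lemma sum_bernardi:
  "finite A \<Longrightarrow> sum (bernardi G v e T) A = int (card {f\<in>E - T. eta G v e T f \<in> A})"
  unfolding bernardi_sum by (rule sum_of_bool_fibers) auto

lemma sum_laplacian:
  assumes "finite A"
  shows "(\<Sum>u\<in>A. laplacian G h u)
    = (\<Sum>f\<in>E. (of_bool (tl_end f \<in> A) - of_bool (hd_end f \<in> A)) * (h (tl_end f) - h (hd_end f)))"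
proof -
  have *: "(\<Sum>u\<in>A. of_bool (u = a)) = (of_bool (a \<in> A) :: int)" for a
    using assms by (simp add: of_bool_def)
  show ?thesis unfolding laplacian_edges
    by (subst sum.swap) (simp add: sum_distrib_right[symmetric] sum_subtractf *)
qed

lemma sum_laplacian_V: "(\<Sum>u\<in>V. laplacian G h u) = 0"
  unfolding sum_laplacian[OF finite_V] using ends_in by (intro sum.neutral) auto

lemma ins_tree_less:
  assumes "T \<in> S G" "A \<subseteq> V" "A \<noteq> {}" shows "card (ins T A) < card A"
proof (rule acyclic_card_less)
  show "acyclic_by (ins T A)"
    using assms acyclic_subset by (auto simp: spanning_tree_iff ins_def)
qed (use assms finite_verts in \<open>auto simp: ins_def\<close>)

text \<open>A non-tree edge inside \<open>A\<close> puts its chip into \<open>A\<close> whichever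
  end is chosen, and a tree has fewer than \<open>card A\<close> edges inside
  \<open>A\<close>.\<close>

lemma break_divisor_feasible:
  assumes D: "D \<in> break_divisors G" and V: "V \<noteq> {}"
  shows "feasible E D"
proof -
  obtain T ch where T: "T \<in> S G" and ch: "\<forall>f\<in>E - T. incident G (ch f) f"
    and D: "D = (\<lambda>x. int (card {f\<in>E - T. ch f = x}))"
    using D by (auto simp: break_divisors_def)
  have TE: "T \<subseteq> E" using T by (auto simp: spanning_tree_iff acyclic_by_def)
  have sumD: "sum D A = int (card {f\<in>E - T. ch f \<in> A})" if "finite A" for A
  proof -
    have "D z = (\<Sum>f\<in>E - T. of_bool (ch f = z))" for z
      unfolding D by (simp add: of_bool_def sum.If_cases Int_def)
    then show ?thesis using sum_of_bool_fibers[OF _ that, of "E - T" ch] by simp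
  qed
  show ?thesis unfolding feasible_def
  proof (intro conjI allI impI)
    fix A assume A: "A \<subseteq> V" "A \<noteq> {}"
    have "ch f \<in> A" if "f \<in> ins E A - ins T A" for f
      using that ch[rule_format, of f] by (auto simp: ins_def incident_def)
    then have "ins E A - ins T A \<subseteq> {f\<in>E - T. ch f \<in> A}" by (auto simp: ins_def)
    then have "card (ins E A - ins T A) \<le> card {f\<in>E - T. ch f \<in> A}" by (intro card_mono) auto
    moreover have "card (ins E A - ins T A) = card (ins E A) - card (ins T A)"
      using TE finite_edges[OF TE] by (intro card_Diff_subset) (auto simp: ins_def)
    moreover have "card (ins T A) < card A" using ins_tree_less[OF T A] .
    ultimately show "int (card (ins E A)) - int (card A) + 1 \<le> sum D A"
      using sumD[OF finite_verts[OF A(1)]] by simp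
  next
    have "{f\<in>E - T. ch f \<in> V} = E - T" using ch incident_in by blast
    then have "sum D V = int (card (E - T))" using sumD by simp
    moreover have "card (E - T) + card T = card E"
      using card_Diff_subset[OF finite_edges[OF TE] TE] card_mono[OF finite_E TE] by simp
    moreover have "card T + 1 = card V" using tree_card[OF T V] .
    ultimately show "sum D V = int (card E) - int (card V) + 1" by simp
  qed
qed

text \<open>If \<open>D - D'\<close> is the Laplacian of a nonconstant function, then the set where that function is
  maximal would receive too many chips for \<open>D\<close> or too few for \<open>D'\<close>.\<close>

lemma feasible_unique:
  assumes D: "feasible E D" and D': "feasible E D'" and eq: "(\<lambda>u. D u - D' u) = laplacian G h"
    and V: "V \<noteq> {}"
  shows "D = D'"
proof -
  define M where "M = Max (h ` V)"
  define A where "A = {u\<in>V. h u = M}"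
  have le: "h u \<le> M" if "u \<in> V" for u unfolding M_def using that by simp
  have "M \<in> h ` V" unfolding M_def using V by (intro Max_in) auto
  then have A: "A \<subseteq> V" "A \<noteq> {}" by (auto simp: A_def)
  have "A = V"
  proof (rule ccontr)
    assume AV: "A \<noteq> V"
    have "int (card (cut E A)) = (\<Sum>f\<in>E. of_bool (f \<in> cut E A))"
      by (simp add: of_bool_def sum.If_cases cut_def Int_def)
    also have "\<dots> \<le> (\<Sum>f\<in>E. (of_bool (tl_end f \<in> A) - of_bool (hd_end f \<in> A)) * (h (tl_end f) - h (hd_end f)))"
    proof (rule sum_mono)
      fix f assume f: "f \<in> E"
      have "h (tl_end f) \<le> M" "h (hd_end f) \<le> M" using le ends_in f by auto
      then show "of_bool (f \<in> cut E A)
          \<le> (of_bool (tl_end f \<in> A) - of_bool (hd_end f \<in> A)) * (h (tl_end f) - h (hd_end f))"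
        using ends_in f by (auto simp: cut_def A_def)
    qed
    also have "\<dots> = sum D A - sum D' A"
      using sum_laplacian[OF finite_verts[OF A(1)], of h] eq
      by (simp add: sum_subtractf[symmetric] fun_cong[OF eq, symmetric])
    finally show False
      using feasible_upper[OF order_refl D A(1) AV] feasible_lower[OF D' A] by linarith
  qed
  then have const: "h u = M" if "u \<in> V" for u using that by (auto simp: A_def)
  have "laplacian G h u = 0" for u
    unfolding laplacian_edges using const ends_in by (intro sum.neutral) auto
  then show ?thesis using fun_cong[OF eq] by (auto simp: fun_eq_iff)
qed

end

section \<open>Two trees whose tours begin alike\<close>

context tour
begin

lemma seen_iff:
  assumes u: "incident G u g" and k: "k \<le> card (darts G)"
  shows "(\<exists>j<k. snd ((tour_step G T ^^ j) d) = g) \<longleftrightarrow> tp T d u g < k \<or> tp T d (other G u g) g < k"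
proof
  assume "\<exists>j<k. snd ((tour_step G T ^^ j) d) = g"
  then obtain j where j: "j < k" "snd ((tour_step G T ^^ j) d) = g" by blast
  let ?u = "fst ((tour_step G T ^^ j) d)"
  have u': "?u = u \<or> ?u = other G u g" using dart_at[of j] j incident_cases[OF u] by simp
  have "(tour_step G T ^^ j) d = (?u, g)" using j(2) by (metis prod.collapse)
  then have "tp T d ?u g = j" using j(1) k by (intro tp_eqI) simp_all
  then show "tp T d u g < k \<or> tp T d (other G u g) g < k" using u' j(1) by auto
next
  assume "tp T d u g < k \<or> tp T d (other G u g) g < k"
  moreover have "snd ((tour_step G T ^^ tp T d u g) d) = g"
    "snd ((tour_step G T ^^ tp T d (other G u g) g) d) = g"
    using tp_funpow[OF u] tp_funpow[OF other_incident[OF u]] by simp_all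
  ultimately show "\<exists>j<k. snd ((tour_step G T ^^ j) d) = g" by blast
qed

lemma bernardi_break: "bd d T \<in> break_divisors G"
  unfolding break_divisors_def bernardi_def using T eta_incident by blast

lemma fundamental_cut:
  assumes t: "t \<in> T" and B: "B = {u\<in>V. reach G (T - {t}) y u}" and g: "g \<in> cut T B"
  shows "g = t"
proof (rule ccontr)
  assume gt: "g \<noteq> t"
  have g': "g \<in> T - {t}" "g \<in> E" using g gt T_sub by (auto simp: cut_def)
  have "reach G (T - {t}) (tl_end g) (hd_end g)"
    using reach_edge[OF g'(1) incident_ends(1)[OF g'(2)]] other_ends g' by simp
  then have "tl_end g \<in> B \<longleftrightarrow> hd_end g \<in> B"
    using ends_in[OF g'(2)] reach_trans reach_sym unfolding B by blast
  then show False using g by (simp add: cut_def)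
qed

end

text \<open>The trees agree on the edges examined before step \<open>k\<close>, so the tours share
  the darts up to and including step \<open>k\<close>; the edge examined there may be treated
  differently.\<close>

locale two_tours = t: tour G T d + t': tour G T' d
  for G :: "('v,'e) rgraph" and T T' d +
  fixes k :: nat
  assumes k: "k < card (darts G)"
    and agree: "\<And>j. j < k \<Longrightarrow> snd ((tour_step G T ^^ j) d) \<in> T \<longleftrightarrow> snd ((tour_step G T ^^ j) d) \<in> T'"
begin

lemma iterates_agree: "j \<le> k \<Longrightarrow> (tour_step G T ^^ j) d = (tour_step G T' ^^ j) d"
proof (induction j)
  case (Suc j)
  have "snd ((tour_step G T ^^ j) d) \<in> T \<longleftrightarrow> snd ((tour_step G T ^^ j) d) \<in> T'"
    using Suc.prems by (intro agree) simp
  then have "tour_step G T ((tour_step G T ^^ j) d) = tour_step G T' ((tour_step G T ^^ j) d)"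
    by (simp add: tour_step_def Let_def)
  then show ?case using Suc by simp
qed simp

lemma tp_agree:
  assumes i: "incident G u g" and "pos (tour_step G T) d (u, g) \<le> k \<or> pos (tour_step G T') d (u, g) \<le> k"
  shows "pos (tour_step G T) d (u, g) = pos (tour_step G T') d (u, g)"
  using assms(2)
proof
  let ?p = "pos (tour_step G T) d (u, g)"
  assume le: "?p \<le> k"
  then show ?thesis
    using t'.tp_eqI[of ?p u g] t.tp_funpow[OF i] iterates_agree[OF le] k by simp
next
  let ?p = "pos (tour_step G T') d (u, g)"
  assume le: "?p \<le> k"
  then show ?thesis
    using t.tp_eqI[of ?p u g] t'.tp_funpow[OF i] iterates_agree[OF le] k by simp
qed

text \<open>If the first dart of an edge lies in the common beginning, the other dart either has the
  same position in both tours or comes after \<open>k\<close> in both.\<close>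

lemma first_agree:
  assumes i: "incident G u g"
  shows "pos (tour_step G T) d (u, g) \<le> k \<and> pos (tour_step G T) d (u, g) < pos (tour_step G T) d (other G u g, g)
    \<longleftrightarrow> pos (tour_step G T') d (u, g) \<le> k \<and> pos (tour_step G T') d (u, g) < pos (tour_step G T') d (other G u g, g)"
  using tp_agree[OF i] tp_agree[OF t.other_incident[OF i]] by linarith

end

text \<open>Count chips on \<open>B\<close>, the side of \<open>T - {f}\<close> beyond
  \<open>f\<close>. With \<open>T\<close> this side is toured right after step \<open>k\<close>, so
  every open cut edge other than \<open>f\<close> is cut from inside \<open>B\<close>. With
  \<open>T'\<close> at least \<open>card B\<close> tree edges touch \<open>B\<close>, and those in
  the cut are open edges as well, so fewer chips remain.\<close>

lemma (in ribbon) bernardi_inj_aux: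
  assumes T: "T \<in> S G" and T': "T' \<in> S G" and d: "d \<in> darts G"
    and eq: "bd d T = bd d T'"
    and k: "k < card (darts G)"
    and before: "\<And>j. j < k \<Longrightarrow> snd ((tour_step G T ^^ j) d) \<in> T \<longleftrightarrow> snd ((tour_step G T ^^ j) d) \<in> T'"
    and now: "(tour_step G T ^^ k) d = (x, f)" "f \<in> T" "f \<notin> T'"
  shows False
proof -
  interpret t: tour G T d using T d by unfold_locales
  interpret t': tour G T' d using T' d by unfold_locales
  interpret tt: two_tours G T T' d k using k before by unfold_locales
  let ?y = "other G x f"
  have x: "incident G x f" using t.dart_at[of k] now by simp
  have y: "incident G ?y f" using other_incident[OF x] .
  have px: "tp T d x f = k" "tp T' d x f = k"
    using t.tp_eqI[OF k now(1)] t'.tp_eqI[OF k, of x f] tt.iterates_agree[of k] now(1) by auto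
  have agree: "tp T d u g = tp T' d u g" if "incident G u g" "tp T d u g \<le> k \<or> tp T' d u g \<le> k" for u g
    using tt.tp_agree that .
  define Seen where "Seen = {g. \<exists>j<k. snd ((tour_step G T ^^ j) d) = g}"
  have seen_iff: "g \<in> Seen \<longleftrightarrow> tp T d u g < k \<or> tp T d (other G u g) g < k" if u: "incident G u g" for u g
    unfolding Seen_def using t.seen_iff[OF u, of k] k by simp
  have seen_status: "g \<in> T \<longleftrightarrow> g \<in> T'" if "g \<in> Seen" for g
    using that before by (auto simp: Seen_def)
  then have fS: "f \<notin> Seen" using now by blast
  have py: "k < tp T d ?y f" "k < tp T' d ?y f"
  proof -
    show "k < tp T d ?y f"
      using fS seen_iff[OF x] px t.tp_neq_other[OF x] by linarith
    then show "k < tp T' d ?y f" using agree[OF y] by (metis not_less)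
  qed
  define B where "B = {u\<in>V. reach G (T - {f}) ?y u}"
  have BV: "B \<subseteq> V" by (auto simp: B_def)
  have yB: "?y \<in> B" using incident_in[OF y] by (simp add: B_def reach_refl)
  have xB: "x \<notin> B" using acyclic_bridge[OF t.T_acyc now(2) x] reach_sym by (auto simp: B_def)
  have finB: "finite B" using finite_verts[OF BV] .
  have seg: "u \<in> B \<longleftrightarrow> k < tp T d u g \<and> tp T d u g \<le> tp T d ?y f" if "incident G u g" for u g
    using t.segment[OF now(2) x _ that] px py incident_in(1)[OF that] by (simp add: B_def)
  have cut_T: "g = f" if "g \<in> cut T B" for g
    using t.fundamental_cut[OF now(2) B_def that] .
  \<comment> \<open>The cut edges still open at step \<open>k\<close>, without \<open>f\<close>.
    Examined edges have the same status in both trees and \<open>f\<close> is the only edge of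
    \<open>T\<close> in this cut, so every edge of \<open>T'\<close> in the cut lies in
    \<open>N\<close>.\<close>
  define N where "N = cut E B - Seen - {f}"
  have "ins E B - ins T B \<union> N \<subseteq> {g\<in>E - T. fcut d T g \<in> B}"
  proof
    fix g assume g: "g \<in> ins E B - ins T B \<union> N"
    have gT: "g \<in> E - T"
      using g cut_T by (auto simp: ins_def N_def cut_def)
    have i: "incident G (fcut d T g) g" using t.eta_incident[OF gT] .
    have "fcut d T g \<in> B"
    proof (cases "g \<in> N")
      case False
      then show ?thesis using g i by (auto simp: ins_def incident_def)
    next
      case True
      have gE: "g \<in> E" using gT by simp
      obtain u where u: "incident G u g" "tp T d u g < tp T d (other G u g) g"
        using t.first_dart[OF gE] .
      have ns: "k \<le> tp T d u g" using seen_iff[OF u(1)] True by (auto simp: N_def)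
      have "tp T d u g \<noteq> k" using t.tp_inj[OF u(1) x] px True by (auto simp: N_def)
      then have lt: "k < tp T d u g" using ns by simp
      have "u \<in> B \<or> other G u g \<in> B"
        using True u(1) other_ends[OF gE] by (auto simp: N_def cut_def incident_def)
      then have "u \<in> B" using seg[OF u(1)] seg[OF other_incident[OF u(1)]] lt u(2) by auto
      then show ?thesis using t.eta_eq[OF gT u] by simp
    qed
    then show "g \<in> {g\<in>E - T. fcut d T g \<in> B}" using gT by simp
  qed
  then have "card (ins E B - ins T B \<union> N) \<le> card {g\<in>E - T. fcut d T g \<in> B}"
    by (intro card_mono) auto
  moreover have "card (ins E B - ins T B \<union> N) = card (ins E B) - card (ins T B) + card N"
  proof -
    have "card (ins E B - ins T B \<union> N) = card (ins E B - ins T B) + card N"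
      by (rule card_Un_disjoint) (auto simp: ins_def N_def cut_def)
    moreover have "card (ins E B - ins T B) = card (ins E B) - card (ins T B)"
      using t.T_sub by (intro card_Diff_subset) (auto simp: ins_def)
    ultimately show ?thesis by simp
  qed
  moreover have "card (ins T B) < card B" using ins_tree_less[OF T BV] yB by blast
  ultimately have low: "int (card (ins E B)) - int (card B) + 1 + int (card N) \<le> sum (bd d T) B"
    unfolding sum_bernardi[OF finB] by simp
  have "{g\<in>E - T'. fcut d T' g \<in> B} \<subseteq> (ins E B - ins T' B) \<union> (N - T')"
  proof
    fix g assume g: "g \<in> {g\<in>E - T'. fcut d T' g \<in> B}"
    then have gT: "g \<in> E - T'" and gE: "g \<in> E" and gB: "fcut d T' g \<in> B" by auto
    obtain u where u: "incident G u g" "tp T' d u g < tp T' d (other G u g) g"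
      using t'.first_dart[OF gE] .
    have uB: "u \<in> B" using gB t'.eta_eq[OF gT u] by simp
    have "g \<in> ins E B \<or> g \<in> cut E B"
      using uB u(1) gE by (auto simp: ins_def cut_def incident_def)
    moreover have "g \<in> N" if c: "g \<in> cut E B"
    proof -
      have "k < tp T d u g" using seg[OF u(1)] uB by blast
      then have ku: "k < tp T' d u g" using agree[OF u(1)] by (metis not_less)
      then have "k < tp T' d (other G u g) g" using u(2) by simp
      then have ko: "k < tp T d (other G u g) g" using agree[OF other_incident[OF u(1)]] by (metis not_less)
      have "g \<notin> Seen" using seen_iff[OF u(1)] \<open>k < tp T d u g\<close> ko by simp
      moreover have "g \<noteq> f"
        using incident_cases[OF x, of u] u(1) other_other[OF x] px ku ko \<open>k < tp T d u g\<close> by fastforce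
      ultimately show ?thesis using c by (simp add: N_def)
    qed
    ultimately show "g \<in> (ins E B - ins T' B) \<union> (N - T')" using gT by (auto simp: ins_def)
  qed
  then have "card {g\<in>E - T'. fcut d T' g \<in> B} \<le> card ((ins E B - ins T' B) \<union> (N - T'))"
    by (intro card_mono) (auto simp: ins_def N_def cut_def)
  also have "\<dots> = card (ins E B - ins T' B) + card (N - T')"
    by (rule card_Un_disjoint) (auto simp: ins_def N_def cut_def)
  finally have "sum (bd d T') B \<le> int (card (ins E B - ins T' B)) + int (card (N - T'))"
    unfolding sum_bernardi[OF finB] by simp
  moreover have "card (ins E B - ins T' B) + card (ins T' B) = card (ins E B)"
  proof -
    have "ins T' B \<subseteq> ins E B" using t'.T_sub by (auto simp: ins_def)
    then show ?thesis using card_Diff_subset[of "ins T' B" "ins E B"] card_mono[of "ins E B" "ins T' B"]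
      by (simp add: ins_def)
  qed
  moreover have "card (N - T') + card (cut T' B) \<le> card N"
  proof -
    have "cut T' B \<subseteq> N"
      using t'.T_sub cut_T seen_status now(3) by (auto simp: cut_def N_def)
    moreover have "finite N" by (simp add: N_def cut_def)
    moreover have "N \<inter> T' = cut T' B" using calculation t'.T_sub by (auto simp: N_def cut_def)
    ultimately show ?thesis by (metis Int_commute card_Int_Diff eq_iff add.commute)
  qed
  moreover have "card B \<le> card (ins T' B) + card (cut T' B)"
  proof -
    have "B \<noteq> V" using xB incident_in(1)[OF x] by blast
    from connected_card_ge[OF t'.T_conn t'.T_sub BV this] show ?thesis
      unfolding card_ins_touch[OF t'.T_sub] .
  qed
  ultimately show False using low eq by simp
qed

lemma (in ribbon) bernardi_inj:
  assumes T: "T \<in> S G" and T': "T' \<in> S G" and d: "d \<in> darts G" and eq: "bd d T = bd d T'"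
  shows "T = T'"
proof (rule ccontr)
  assume ne: "T \<noteq> T'"
  interpret t: tour G T d using T d by unfold_locales
  interpret t': tour G T' d using T' d by unfold_locales
  let ?g = "\<lambda>j. snd ((tour_step G T ^^ j) d)"
  let ?Q = "\<lambda>j. (?g j \<in> T) \<noteq> (?g j \<in> T')"
  obtain f where f: "(f \<in> T) \<noteq> (f \<in> T')" using ne by blast
  then have "f \<in> E" using t.T_sub t'.T_sub by blast
  then have i: "incident G (tl_end f) f" by (rule incident_ends)
  have Q: "?Q (tp T d (tl_end f) f)" using f t.tp_funpow[OF i] by simp
  define k where "k = (LEAST j. ?Q j)"
  have Qk: "?Q k" unfolding k_def using Q by (rule LeastI)
  have before: "?g j \<in> T \<longleftrightarrow> ?g j \<in> T'" if "j < k" for j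
    using that not_less_Least[of j ?Q] unfolding k_def by blast
  have "k \<le> tp T d (tl_end f) f" unfolding k_def using Q by (rule Least_le)
  then have kN: "k < card (darts G)" using t.tp_less[OF i] by simp
  interpret tt: two_tours G T T' d k using kN before by unfold_locales
  note same = tt.iterates_agree
  obtain x f where xf: "(tour_step G T ^^ k) d = (x, f)" by fastforce
  show False
  proof (cases "f \<in> T")
    case True
    then show False
      using bernardi_inj_aux[OF T T' d eq kN before xf] Qk xf by simp
  next
    case False
    have before': "snd ((tour_step G T' ^^ j) d) \<in> T' \<longleftrightarrow> snd ((tour_step G T' ^^ j) d) \<in> T" if "j < k" for j
      using before[OF that] same[of j] that by simp
    show False
      using bernardi_inj_aux[OF T' T d eq[symmetric] kN before', of x f] Qk xf False same[of k]
      by simp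
  qed
qed

section \<open>Every class of degree g contains a feasible divisor\<close>

context ribbon
begin

text \<open>\<open>K\<close> is the length of a walk from \<open>u\<close> to \<open>w\<close>,
  hence uniform in \<open>h\<close>.\<close>

lemma potential_bound:
  assumes "reach G E u w"
  shows "\<exists>K\<ge>0. \<forall>h :: 'v \<Rightarrow> int. \<bar>h w - h u\<bar> \<le> K * (\<Sum>f\<in>E. \<bar>h (tl_end f) - h (hd_end f)\<bar>)"
  using assms
proof (induction rule: reach_induct)
  case refl
  show ?case by (intro exI[of _ 0]) simp
next
  case (step x g)
  let ?s = "\<lambda>h :: 'v \<Rightarrow> int. \<Sum>f\<in>E. \<bar>h (tl_end f) - h (hd_end f)\<bar>"
  obtain K where K: "K \<ge> 0" "\<And>h :: 'v \<Rightarrow> int. \<bar>h x - h u\<bar> \<le> K * ?s h" using step.IH by blast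
  have "\<bar>h (other G x g) - h u\<bar> \<le> (K + 1) * ?s h" for h :: "'v \<Rightarrow> int"
  proof -
    have "\<bar>h (tl_end g) - h (hd_end g)\<bar> \<le> ?s h"
      using step.hyps by (intro member_le_sum) auto
    moreover have "\<bar>h (other G x g) - h x\<bar> = \<bar>h (tl_end g) - h (hd_end g)\<bar>"
      using step.hyps(3) by (auto simp: incident_def other_def)
    ultimately show ?thesis using K(2)[of h] by (simp add: algebra_simps)
  qed
  then show ?case using K(1) by (intro exI[of _ "K + 1"]) auto
qed

text \<open>A form that vanishes on constants only sees differences to a base vertex
  \<open>q\<close>.\<close>

lemma linear_form_bound:
  assumes b: "sum b V = (0 :: int)" and V: "V \<noteq> {}"
  shows "\<exists>K\<ge>0. \<forall>h. (\<Sum>u\<in>V. b u * h u) \<le> K * (\<Sum>f\<in>E. \<bar>h (tl_end f) - h (hd_end f)\<bar>)"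
proof -
  let ?s = "\<lambda>h :: 'v \<Rightarrow> int. \<Sum>f\<in>E. \<bar>h (tl_end f) - h (hd_end f)\<bar>"
  obtain q where q: "q \<in> V" using V by blast
  have "\<forall>u\<in>V. \<exists>K\<ge>0. \<forall>h. \<bar>h u - h q\<bar> \<le> K * ?s h"
    using potential_bound connected q by (auto simp: connected_by_def)
  then obtain K where K: "\<And>u. u \<in> V \<Longrightarrow> K u \<ge> 0" "\<And>u h. u \<in> V \<Longrightarrow> \<bar>h u - h q\<bar> \<le> K u * ?s h"
    by metis
  have "(\<Sum>u\<in>V. b u * h u) \<le> (\<Sum>u\<in>V. \<bar>b u\<bar> * K u) * ?s h" for h
  proof -
    have "(\<Sum>u\<in>V. b u * h u) = (\<Sum>u\<in>V. b u * (h u - h q))"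
      using b by (simp add: right_diff_distrib sum_subtractf sum_distrib_right[symmetric])
    also have "\<dots> \<le> (\<Sum>u\<in>V. \<bar>b u\<bar> * K u * ?s h)"
    proof (rule sum_mono)
      fix u assume u: "u \<in> V"
      have "b u * (h u - h q) \<le> \<bar>b u\<bar> * \<bar>h u - h q\<bar>" by (metis abs_ge_self abs_mult)
      also have "\<dots> \<le> \<bar>b u\<bar> * (K u * ?s h)" using K(2)[OF u] by (intro mult_left_mono) auto
      finally show "b u * (h u - h q) \<le> \<bar>b u\<bar> * K u * ?s h" by (simp add: mult.assoc)
    qed
    finally show ?thesis by (simp add: sum_distrib_right)
  qed
  moreover have "(\<Sum>u\<in>V. \<bar>b u\<bar> * K u) \<ge> 0" using K(1) by (intro sum_nonneg) auto
  ultimately show ?thesis by blast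
qed

text \<open>Values are integers, so a lower bound already yields a minimum. The bound exists because
  the linear part, like the energy, ignores constants.\<close>

lemma quadratic_form_attains_min:
  assumes b: "sum b V = (0 :: int)" and V: "V \<noteq> {}" and n: "n \<ge> 1"
  defines "Q h \<equiv> n * (\<Sum>f\<in>E. (h (tl_end f) - h (hd_end f))\<^sup>2) - (\<Sum>u\<in>V. b u * h u)"
  shows "\<exists>h. \<forall>h'. Q h \<le> Q h'"
proof -
  obtain K where K: "K \<ge> 0"
    "\<And>h. (\<Sum>u\<in>V. b u * h u) \<le> K * (\<Sum>f\<in>E. \<bar>h (tl_end f) - h (hd_end f)\<bar>)"
    using linear_form_bound[OF b V] by blast
  \<comment> \<open>Each edge contributes at least \<open>- (K * K)\<close>: a difference of size at
    least \<open>K\<close> has its square dominate the linear term, and a smaller one keeps that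
    term below \<open>K * K\<close>.\<close>
  define C where "C = int (card E) * (K * K)"
  have pos: "0 \<le> Q h + C" for h
  proof -
    have "- C = (\<Sum>f\<in>E. - (K * K))" by (simp add: C_def)
    also have "\<dots> \<le> (\<Sum>f\<in>E. n * (h (tl_end f) - h (hd_end f))\<^sup>2 - K * \<bar>h (tl_end f) - h (hd_end f)\<bar>)"
    proof (rule sum_mono)
      fix f
      let ?d = "h (tl_end f) - h (hd_end f)"
      have "\<bar>?d\<bar> * \<bar>?d\<bar> \<le> n * ?d\<^sup>2" using n mult_right_mono[of 1 n "?d\<^sup>2"] by (simp add: power2_eq_square)
      moreover have "K * \<bar>?d\<bar> \<le> \<bar>?d\<bar> * \<bar>?d\<bar> + K * K"
      proof (cases "K \<le> \<bar>?d\<bar>")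
        case True
        then have "K * \<bar>?d\<bar> \<le> \<bar>?d\<bar> * \<bar>?d\<bar>" by (intro mult_right_mono) auto
        moreover have "0 \<le> K * K" using K(1) by simp
        ultimately show ?thesis by linarith
      next
        case False
        then have "K * \<bar>?d\<bar> \<le> K * K" using K(1) by (intro mult_left_mono) auto
        moreover have "0 \<le> \<bar>?d\<bar> * \<bar>?d\<bar>" by simp
        ultimately show ?thesis by linarith
      qed
      ultimately show "- (K * K) \<le> n * ?d\<^sup>2 - K * \<bar>?d\<bar>" by linarith
    qed
    also have "\<dots> \<le> Q h"
      unfolding Q_def using K(2)[of h] by (simp add: sum_subtractf sum_distrib_left)
    finally show ?thesis by simp
  qed
  obtain h where h: "\<forall>h'. nat (Q h + C) \<le> nat (Q h' + C)"
    using ex_has_least_nat[of "\<lambda>_. True" undefined "\<lambda>h. nat (Q h + C)"] by blast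
  have "Q h \<le> Q h'" for h'
    using h[rule_format, of h'] pos[of h] pos[of h'] by simp
  then show ?thesis by blast
qed

lemma sum_edge_ends:
  assumes "A \<subseteq> V"
  shows "(\<Sum>u\<in>A. \<Sum>f\<in>E. of_bool (u = tl_end f) + of_bool (u = hd_end f))
    = 2 * int (card (ins E A)) + int (card (cut E A))"
proof -
  have finA: "finite A" using finite_verts[OF assms] .
  have "(\<Sum>u\<in>A. \<Sum>f\<in>E. of_bool (u = tl_end f) + of_bool (u = hd_end f))
      = (\<Sum>f\<in>E. \<Sum>u\<in>A. of_bool (u = tl_end f) + of_bool (u = hd_end f) :: int)"
    by (rule sum.swap)
  also have "\<dots> = (\<Sum>f\<in>E. of_bool (tl_end f \<in> A) + of_bool (hd_end f \<in> A))"
    using finA by (intro sum.cong refl) (simp add: sum.distrib of_bool_def)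
  also have "\<dots> = (\<Sum>f\<in>E. 2 * of_bool (f \<in> ins E A) + of_bool (f \<in> cut E A))"
    by (intro sum.cong refl) (auto simp: ins_def cut_def)
  also have "\<dots> = 2 * int (card (ins E A)) + int (card (cut E A))"
    by (simp add: sum.distrib sum_distrib_left[symmetric] of_bool_def sum.If_cases Int_def ins_def cut_def)
  finally show ?thesis .
qed

text \<open>Minimise a suitably recentred energy over the class of \<open>D\<close>. Stability of the minimiser
  under firing \<open>A\<close> is the upper bound for \<open>A\<close> up to a tie; the terms \<open>of_bool (u = q)\<close> and
  \<open>- 1\<close> in \<open>b\<close>, the latter small against the factor \<open>n\<close>, break the ties.\<close>

lemma feasible_exists:
  assumes V: "V \<noteq> {}" and D: "sum D V = int (card E) - int (card V) + 1"
  shows "\<exists>h. feasible E (\<lambda>u. D u - laplacian G h u)"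
proof -
  obtain q where q: "q \<in> V" using V by blast
  define n where "n = int (card V)"
  have n: "n \<ge> 1" using V by (simp add: n_def Suc_leI card_gt_0_iff)
  define dg where "dg u = (\<Sum>f\<in>E. of_bool (u = tl_end f) + of_bool (u = hd_end f) :: int)" for u
  define b where "b u = n * (2 * D u - dg u + 2 - of_bool (u = q)) - 1" for u
  have sum_b: "sum b A = n * (2 * sum D A - 2 * int (card (ins E A)) - int (card (cut E A))
      + 2 * int (card A) - of_bool (q \<in> A)) - int (card A)" if A: "A \<subseteq> V" for A
  proof -
    have finA: "finite A" using finite_verts[OF A] .
    have "sum b A = n * (\<Sum>u\<in>A. 2 * D u - dg u + 2 - of_bool (u = q)) - int (card A)"
      unfolding b_def sum_distrib_left by (subst sum_subtractf) simp
    also have "(\<Sum>u\<in>A. 2 * D u - dg u + 2 - of_bool (u = q))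
        = 2 * sum D A - sum dg A + 2 * int (card A) - of_bool (q \<in> A)"
      using finA by (simp add: sum_subtractf sum.distrib sum_distrib_left of_bool_def)
    also have "sum dg A = 2 * int (card (ins E A)) + int (card (cut E A))"
      unfolding dg_def using sum_edge_ends[OF A] .
    finally show ?thesis by simp
  qed
  have insV: "ins E V = E" "cut E V = {}" using ends_in by (auto simp: ins_def cut_def)
  \<comment> \<open>For \<open>A = V\<close> the bracket in \<open>sum_b\<close> is 2 without the
    term for \<open>q\<close> and 1 with it; subtracting 1 at each of the \<open>n\<close> vertices
    removes the rest.\<close>
  have "sum b V = 0"
    using sum_b[OF order_refl] q by (simp add: insV D n_def algebra_simps)
  then obtain h where h: "\<And>h'. n * (\<Sum>f\<in>E. (h (tl_end f) - h (hd_end f))\<^sup>2) - (\<Sum>u\<in>V. b u * h u)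
      \<le> n * (\<Sum>f\<in>E. (h' (tl_end f) - h' (hd_end f))\<^sup>2) - (\<Sum>u\<in>V. b u * h' u)"
    using quadratic_form_attains_min[OF _ V n] by blast
  let ?D = "\<lambda>u. D u - laplacian G h u"
  have totalD: "sum ?D V = int (card E) - int (card V) + 1"
    using D sum_laplacian_V by (simp add: sum_subtractf)
  have upper: "sum ?D A \<le> int (card (ins E A)) + int (card (cut E A)) - int (card A)"
    if A: "A \<subseteq> V" "A \<noteq> V" for A
  proof -
    let ?L = "\<Sum>u\<in>A. laplacian G h u"
    let ?e = "\<lambda>f. of_bool (tl_end f \<in> A) - of_bool (hd_end f \<in> A) :: int"
    let ?d = "\<lambda>f. h (tl_end f) - h (hd_end f)"
    have finA: "finite A" using finite_verts[OF A(1)] .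
    have energy: "(\<Sum>f\<in>E. (?d f + ?e f)\<^sup>2) = (\<Sum>f\<in>E. (?d f)\<^sup>2) + (2 * ?L + int (card (cut E A)))"
    proof -
      have "(\<Sum>f\<in>E. (?d f + ?e f)\<^sup>2) = (\<Sum>f\<in>E. (?d f)\<^sup>2 + 2 * (?e f * ?d f) + of_bool (f \<in> cut E A))"
        by (intro sum.cong refl) (auto simp: cut_def power2_eq_square algebra_simps)
      also have "\<dots> = (\<Sum>f\<in>E. (?d f)\<^sup>2) + 2 * (\<Sum>f\<in>E. ?e f * ?d f) + (\<Sum>f\<in>E. of_bool (f \<in> cut E A))"
        by (simp add: sum.distrib sum_distrib_left)
      also have "(\<Sum>f\<in>E. of_bool (f \<in> cut E A)) = int (card (cut E A))"
        by (simp add: of_bool_def sum.If_cases cut_def Int_def)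
      finally show ?thesis using sum_laplacian[OF finA, of h] by simp
    qed
    have linear: "(\<Sum>u\<in>V. b u * (h u + of_bool (u \<in> A))) = (\<Sum>u\<in>V. b u * h u) + sum b A"
    proof -
      have "(\<Sum>u\<in>V. b u * of_bool (u \<in> A)) = sum b A"
        using A(1) by (simp add: of_bool_def if_distrib sum.If_cases Int_absorb1 cong: if_cong)
      then show ?thesis by (simp add: distrib_left sum.distrib)
    qed
    have fired: "(\<Sum>f\<in>E. (h (tl_end f) + of_bool (tl_end f \<in> A) - (h (hd_end f) + of_bool (hd_end f \<in> A)))\<^sup>2)
        = (\<Sum>f\<in>E. (?d f + ?e f)\<^sup>2)"
      by (intro sum.cong refl arg_cong[where f = "\<lambda>x. x\<^sup>2"]) simp
    have stable: "sum b A \<le> n * (2 * ?L + int (card (cut E A)))"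
      using h[of "\<lambda>u. h u + of_bool (u \<in> A)"] unfolding fired energy linear distrib_left[of n]
      by linarith
    have sum_D: "sum ?D A = sum D A - ?L" by (rule sum_subtractf)
    define X where "X = sum ?D A - int (card (ins E A)) - int (card (cut E A)) + int (card A)"
    have "card A < card V" using A by (intro psubset_card_mono) auto
    then have less: "int (card A) < n * 1" by (simp add: n_def)
    have "n * (2 * X - of_bool (q \<in> A)) \<le> int (card A)"
      using stable unfolding sum_b[OF A(1)] X_def sum_D by (simp add: algebra_simps)
    also note less
    finally have "n * (2 * X - of_bool (q \<in> A)) < n * 1" .
    then have "2 * X - of_bool (q \<in> A) < 1" using n by (simp only: mult_less_cancel_left_pos)
    then have "X \<le> 0" by (auto simp: of_bool_def split: if_splits)
    then show ?thesis by (simp add: X_def)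
  qed
  have "feasible E ?D" unfolding feasible_def
  proof (intro conjI allI impI)
    fix A assume A: "A \<subseteq> V" "A \<noteq> {}"
    have cut: "cut E (V - A) = cut E A" using ends_in by (auto simp: cut_def)
    have "sum ?D (V - A) \<le> int (card (ins E (V - A))) + int (card (cut E A)) - int (card (V - A))"
      using upper[of "V - A"] A cut by auto
    then show "int (card (ins E A)) - int (card A) + 1 \<le> sum ?D A"
      using totalD sum_split_V[OF A(1), of ?D] card_split_V[OF A(1)] card_ins_cut[of E A]
      by simp
  qed (rule totalD)
  then show ?thesis by blast
qed

end

section \<open>Surjectivity of the Bernardi map\<close>

context ribbon
begin

definition tight :: "'e set \<Rightarrow> ('v \<Rightarrow> int) \<Rightarrow> 'v set \<Rightarrow> bool" where
  "tight H D A \<longleftrightarrow> A \<subseteq> V \<and> sum D A = int (card (ins H A)) - int (card A) + 1"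

definition remove_chip :: "('v \<Rightarrow> int) \<Rightarrow> 'v \<Rightarrow> 'v \<Rightarrow> int" where
  "remove_chip D x = (\<lambda>z. D z - of_bool (x = z))"

lemma sum_remove_chip: "finite A \<Longrightarrow> sum (remove_chip D x) A = sum D A - of_bool (x \<in> A)"
  by (simp add: remove_chip_def sum_subtractf of_bool_def)

lemma ins_remove:
  assumes "H \<subseteq> E" "f \<in> H" "incident G x f"
  shows "card (ins (H - {f}) A) + of_bool (x \<in> A \<and> other G x f \<in> A) = card (ins H A)"
proof (cases "x \<in> A \<and> other G x f \<in> A")
  case True
  then have "f \<in> ins H A" using assms by (auto simp: ins_def incident_def other_def split: if_splits)
  moreover have "ins (H - {f}) A = ins H A - {f}" by (auto simp: ins_def)
  moreover have "finite (ins H A)" using finite_edges[OF assms(1)] by (simp add: ins_def)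
  ultimately show ?thesis using True card.remove[of "ins H A" f] by simp
next
  case False
  then have "f \<notin> ins H A" using assms by (auto simp: ins_def incident_def other_def split: if_splits)
  then have "ins (H - {f}) A = ins H A" by (auto simp: ins_def)
  then show ?thesis using False by simp
qed

text \<open>Deleting \<open>f\<close> with a chip at \<open>x\<close> lowers chips and edge count
  alike, except on sets that contain \<open>x\<close> but not the other end. There only the chips
  drop, which is fatal only for a tight set.\<close>

lemma not_feasible_remove:
  assumes H: "H \<subseteq> E" "f \<in> H" "incident G x f" and D: "feasible H D"
    and not: "\<not> feasible (H - {f}) (remove_chip D x)"
  obtains A where "tight H D A" "x \<in> A" "other G x f \<notin> A"
proof -
  have "sum (remove_chip D x) V = int (card (H - {f})) - int (card V) + 1"
  proof -
    have "card H = Suc (card (H - {f}))" using card.remove[OF finite_edges[OF H(1)] H(2)] by simp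
    then show ?thesis using feasible_total[OF D] sum_remove_chip[OF finite_V] incident_in[OF H(3)] by simp
  qed
  then obtain A where A: "A \<subseteq> V" "A \<noteq> {}"
    "\<not> int (card (ins (H - {f}) A)) - int (card A) + 1 \<le> sum (remove_chip D x) A"
    using not by (auto simp: feasible_def)
  have "sum (remove_chip D x) A = sum D A - of_bool (x \<in> A)"
    using sum_remove_chip[OF finite_verts[OF A(1)]] .
  then have "tight H D A \<and> x \<in> A \<and> other G x f \<notin> A"
    using A feasible_lower[OF D A(1,2)] ins_remove[OF H, of A]
    by (auto simp: tight_def of_bool_def split: if_splits)
  then show thesis using that by blast
qed

text \<open>The deletion never increases the slack of a set, and feasibility afterwards keeps it
  from becoming negative.\<close>

lemma tight_remove:
  assumes H: "H \<subseteq> E" "f \<in> H" "incident G x f"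
    and D: "feasible (H - {f}) (remove_chip D x)" and A: "tight H D A" "A \<noteq> {}"
  shows "tight (H - {f}) (remove_chip D x) A"
proof -
  have AV: "A \<subseteq> V" using A by (simp add: tight_def)
  have "sum (remove_chip D x) A = sum D A - of_bool (x \<in> A)"
    using sum_remove_chip[OF finite_verts[OF AV]] .
  then show ?thesis using A AV feasible_lower[OF D AV A(2)] ins_remove[OF H, of A]
    by (auto simp: tight_def of_bool_def split: if_splits)
qed

text \<open>Over an empty cut the lower bound for \<open>A\<close> would exceed the upper one by
  1.\<close>

lemma feasible_connected:
  assumes "H \<subseteq> E" "feasible H D" "A \<subseteq> V" "A \<noteq> {}" "A \<noteq> V"
  shows "cut H A \<noteq> {}"
  using feasible_lower[OF assms(2-4)] feasible_upper[OF assms(1-3,5)] by auto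

text \<open>The defect of a vertex set is submodular on intersecting pairs, strictly so when some edge
  joins the two differences.\<close>

lemma tight_union:
  assumes H: "H \<subseteq> E" and D: "feasible H D" and A: "tight H D A" and B: "tight H D B"
    and t: "t \<in> H" "incident G a t" "a \<in> A" "a \<notin> B" "other G a t \<in> B" "other G a t \<notin> A"
  shows "A \<inter> B = {}" and "tight H D (A \<union> B)"
    and "\<And>f x. f \<in> H \<Longrightarrow> incident G x f \<Longrightarrow> x \<in> A \<Longrightarrow> other G x f \<in> B \<Longrightarrow> f = t"
proof -
  have AV: "A \<subseteq> V" and BV: "B \<subseteq> V" using A B by (auto simp: tight_def)
  have finA: "finite A" and finB: "finite B" using finite_verts AV BV by auto
  have fin: "finite (ins H Z)" for Z using finite_edges[OF H] by (simp add: ins_def)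
  have tAB: "t \<in> ins H (A \<union> B)" "t \<notin> ins H A" "t \<notin> ins H B"
    using t by (auto simp: ins_def incident_def other_def split: if_splits)
  have cards: "card (ins H A \<union> ins H B) + card (ins H (A \<inter> B)) = card (ins H A) + card (ins H B)"
  proof -
    have "ins H A \<inter> ins H B = ins H (A \<inter> B)" by (auto simp: ins_def)
    then show ?thesis using card_Un_Int[OF fin fin, of A B] by simp
  qed
  have "insert t (ins H A \<union> ins H B) \<subseteq> ins H (A \<union> B)" using tAB by (auto simp: ins_def)
  then have "card (insert t (ins H A \<union> ins H B)) \<le> card (ins H (A \<union> B))"
    by (intro card_mono fin)
  then have super: "card (ins H A \<union> ins H B) + 1 \<le> card (ins H (A \<union> B))"
    using tAB fin by simp
  have modular: "sum D (A \<union> B) + sum D (A \<inter> B) = sum D A + sum D B"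
    using sum.union_inter[OF finA finB] .
  have modular_card: "card (A \<union> B) + card (A \<inter> B) = card A + card B"
    using card_Un_Int[OF finA finB] by simp
  have low: "int (card (ins H (A \<union> B))) - int (card (A \<union> B)) + 1 \<le> sum D (A \<union> B)"
    using feasible_lower[OF D, of "A \<union> B"] AV BV t by blast
  show disj: "A \<inter> B = {}"
  proof (rule ccontr)
    assume "A \<inter> B \<noteq> {}"
    then have "int (card (ins H (A \<inter> B))) - int (card (A \<inter> B)) + 1 \<le> sum D (A \<inter> B)"
      using AV by (intro feasible_lower[OF D]) auto
    then show False using low super cards modular modular_card A B by (simp add: tight_def)
  qed
  then have "ins H (A \<inter> B) = {}" by (simp add: ins_def)
  then have eq: "card (ins H (A \<union> B)) \<le> card (ins H A \<union> ins H B) + 1"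
    using low cards modular modular_card disj A B by (simp add: tight_def)
  show "tight H D (A \<union> B)"
    using eq super cards modular modular_card disj A B \<open>ins H (A \<inter> B) = {}\<close> by (simp add: tight_def)
  fix f x assume f: "f \<in> H" "incident G x f" "x \<in> A" "other G x f \<in> B"
  show "f = t"
  proof (rule ccontr)
    assume "f \<noteq> t"
    have fAB: "f \<in> ins H (A \<union> B)" "f \<notin> ins H A" "f \<notin> ins H B"
      using f disj by (auto simp: ins_def incident_def other_def split: if_splits)
    then have "insert f (insert t (ins H A \<union> ins H B)) \<subseteq> ins H (A \<union> B)" using tAB by (auto simp: ins_def)
    then have "card (insert f (insert t (ins H A \<union> ins H B))) \<le> card (ins H (A \<union> B))"
      by (intro card_mono fin)
    then show False using eq fAB tAB fin \<open>f \<noteq> t\<close> by simp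
  qed
qed

text \<open>A minimal edge set joining \<open>x\<close> and \<open>y\<close> serves as the
  path.\<close>

lemma minimal_path:
  assumes "reach G W x y" "W \<subseteq> E"
  obtains P where "P \<subseteq> W" "reach G P x y" "\<And>t. t \<in> P \<Longrightarrow> \<not> reach G (P - {t}) x y"
proof -
  obtain P where P: "P \<subseteq> W \<and> reach G P x y"
    and min: "\<And>P'. P' \<subseteq> W \<and> reach G P' x y \<Longrightarrow> card P \<le> card P'"
    using ex_has_least_nat[of "\<lambda>P. P \<subseteq> W \<and> reach G P x y" W card] assms by blast
  have "finite P" using P assms(2) finite_edges by blast
  then have "\<not> reach G (P - {t}) x y" if "t \<in> P" for t
    using min[of "P - {t}"] P that card_Diff1_less[of P t] by (meson Diff_subset not_less subset_trans)
  then show thesis using that P by blast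
qed

text \<open>A path in \<open>T\<close> from \<open>x\<close> to \<open>y\<close> has an edge
  \<open>t\<close> outside \<open>W\<close>. Its remaining pieces join \<open>x\<close> and
  \<open>y\<close> to the two ends of \<open>t\<close>, so another connection in
  \<open>T - {t}\<close> would close a cycle through \<open>t\<close>.\<close>

lemma separating_edge:
  assumes T: "acyclic_by T" "reach G T x y" and W: "\<not> reach G W x y"
  obtains t where "t \<in> T" "t \<notin> W" "\<not> reach G (T - {t}) x y"
proof -
  have TE: "T \<subseteq> E" using T by (simp add: acyclic_by_def)
  obtain P where P: "P \<subseteq> T" "reach G P x y" "\<And>t. t \<in> P \<Longrightarrow> \<not> reach G (P - {t}) x y"
    using minimal_path[OF T(2) TE] by blast
  have "\<not> P \<subseteq> W" using reach_mono[OF P(2)] W by blast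
  then obtain t where t: "t \<in> P" "t \<notin> W" by blast
  let ?R = "reach G (P - {t})" and ?a = "tl_end t"
  let ?b = "other G ?a t"
  have a: "incident G ?a t" using incident_ends t P(1) TE by blast
  have "?R x y \<or> ?R ?a y \<or> ?R ?b y" "?R y x \<or> ?R ?a x \<or> ?R ?b x"
    using reach_remove[OF P(2) a] reach_remove[OF reach_sym[OF P(2)] a] .
  then have ends: "(?R ?a x \<and> ?R ?b y) \<or> (?R ?b x \<and> ?R ?a y)"
    using P(3)[OF t(1)] reach_sym reach_trans by meson
  have "\<not> reach G (T - {t}) x y"
  proof
    assume xy: "reach G (T - {t}) x y"
    have up: "?R u w \<Longrightarrow> reach G (T - {t}) u w" for u w
      using reach_mono[of "P - {t}" u w "T - {t}"] P(1) by blast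
    have "reach G (T - {t}) ?a ?b"
      using ends
    proof
      assume "?R ?a x \<and> ?R ?b y"
      then show ?thesis using up xy reach_trans reach_sym by metis
    next
      assume "?R ?b x \<and> ?R ?a y"
      then show ?thesis using up xy reach_trans reach_sym by metis
    qed
    then show False using acyclic_bridge[OF T(1) _ a] t P(1) by blast
  qed
  then show thesis using that t P(1) by blast
qed

end

context tour
begin

text \<open>The end \<open>y\<close> of the edge cut at \<open>x\<close> is visited later than \<open>x\<close>, so an all-seen tree path
  from \<open>x\<close> to \<open>y\<close> only runs towards the root, and tight sets propagate along it from \<open>x\<close> to \<open>y\<close>.\<close>

lemma tight_blocks_seen_path:
  assumes H: "H \<subseteq> E" "W \<subseteq> H" "W \<subseteq> T" and D: "feasible H D"
    and f: "f \<in> H" "f \<notin> T" "incident G x f" and later: "tp T d x f < tp T d (other G x f) f"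
    and A0: "tight H D A0" "x \<in> A0" "other G x f \<notin> A0"
    and seen: "\<And>t u. t \<in> W \<Longrightarrow> incident G u t \<Longrightarrow> tp T d u t < tp T d (other G u t) t \<Longrightarrow>
      tp T d u t < tp T d x f \<and> (\<exists>B. tight H D B \<and> u \<in> B \<and> other G u t \<notin> B)"
  shows "\<not> reach G W x (other G x f)"
proof
  let ?y = "other G x f"
  assume "reach G W x ?y"
  then obtain P where P: "P \<subseteq> W" "reach G P x ?y" "\<And>t. t \<in> P \<Longrightarrow> \<not> reach G (P - {t}) x ?y"
    using minimal_path H by (metis subset_trans)
  have y: "incident G ?y f" using other_incident[OF f(3)] .
  let ?Q = "\<lambda>A. tight H D A \<and> x \<in> A \<and> ?y \<notin> A"
  have bound: "card A < Suc (card V)" if "?Q A" for A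
    using that card_mono[of V A] by (simp add: tight_def less_Suc_eq_le)
  \<comment> \<open>With \<open>A\<close> as large as possible, absorbing another tight set through
    \<open>tight_union\<close> becomes the contradiction.\<close>
  obtain A where A: "?Q A" and maxA: "\<And>A'. ?Q A' \<Longrightarrow> card A' \<le> card A"
    using ex_has_greatest_nat[of ?Q A0 card "Suc (card V)"] A0 bound by blast
  have finA: "finite A" using A finite_verts by (simp add: tight_def)
  define X where "X = {u. reach G (ins P A) x u}"
  have XA: "u \<in> A" if "u \<in> X" for u
  proof -
    have "reach G (ins P A) x u" using that by (simp add: X_def)
    then show ?thesis
    proof (induction rule: reach_induct)
      case (step z g)
      then show ?case by (auto simp: ins_def other_def)
    qed (use A in simp)
  qed
  have "x \<in> X" "?y \<notin> X" using reach_refl XA A by (auto simp: X_def)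
  then obtain a t where t: "t \<in> P" "incident G a t" "a \<in> X" "other G a t \<notin> X"
    using reach_exit[OF P(2)] by blast
  let ?b = "other G a t"
  have aA: "a \<in> A" using XA t by blast
  have bA: "?b \<notin> A"
  proof
    assume "?b \<in> A"
    then have "t \<in> ins P A"
      using t(1,2) aA by (auto simp: ins_def incident_def other_def split: if_splits)
    then have "?b \<in> X" using t(2,3) reach_trans[OF _ reach_edge] unfolding X_def by blast
    then show False using t by blast
  qed
  have "t \<notin> ins P A" using bA t(2) by (auto simp: ins_def incident_def other_def split: if_splits)
  then have xa: "reach G (P - {t}) x a"
    using t(3) reach_mono[of "ins P A" x a "P - {t}"] by (auto simp: X_def ins_def)
  have nxy: "\<not> reach G (P - {t}) x ?y" using P(3) t(1) .
  then have "\<not> reach G (P - {t}) a ?y" using xa reach_trans by blast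
  then have by_P: "reach G (P - {t}) ?b ?y" using reach_remove[OF P(2) t(2)] nxy by blast
  have tT: "t \<in> T" "t \<in> W" "t \<in> H" using t(1) P(1) H by auto
  have up: "reach G (P - {t}) u w \<Longrightarrow> reach G (T - {t}) u w" for u w
    using reach_mono[of "P - {t}" u w "T - {t}"] P(1) H by blast
  have bx: "\<not> reach G (T - {t}) ?b x"
    using acyclic_bridge[OF T_acyc tT(1) t(2)] up[OF xa] reach_trans reach_sym by blast
  have ft: "f \<noteq> t" using f(2) tT by blast
  show False
  proof (cases "tp T d a t < tp T d ?b t")
    case True
    \<comment> \<open>Here \<open>t\<close> leads away from the root, with \<open>?y\<close> beyond
      it and \<open>x\<close> not. Since \<open>t\<close> is crossed before \<open>x\<close> is
      examined, the whole stay beyond \<open>t\<close>, including the dart at \<open>?y\<close>,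
      precedes the dart at \<open>x\<close>, against \<open>later\<close>.\<close>
    have "tp T d a t < tp T d x f" using seen[OF tT(2) t(2) True] by blast
    moreover have "tp T d a t < tp T d ?y f \<and> tp T d ?y f \<le> tp T d ?b t"
      using segment[OF tT(1) t(2) True y] up[OF by_P] by blast
    moreover have "\<not> (tp T d a t < tp T d x f \<and> tp T d x f \<le> tp T d ?b t)"
      using segment[OF tT(1) t(2) True f(3)] bx by blast
    ultimately show False using later by linarith
  next
    case False
    have b: "incident G ?b t" using other_incident[OF t(2)] .
    have less: "tp T d ?b t < tp T d (other G ?b t) t"
      using False tp_neq_other[OF t(2)] other_other[OF t(2)] by simp
    \<comment> \<open>Now \<open>t\<close> was first walked from \<open>?b\<close>, which supplies a
      tight set to join to \<open>A\<close>. The union still misses \<open>?y\<close>, as otherwise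
      \<open>f\<close> would be a second edge between \<open>A\<close> and \<open>B\<close>.\<close>
    obtain B where B: "tight H D B" "?b \<in> B" "a \<notin> B"
      using seen[OF tT(2) b less] other_other[OF t(2)] by auto
    note union = tight_union[OF H(1) D conjunct1[OF A] B(1) tT(3) t(2) aA B(3,2) bA]
    have "?y \<notin> B" using union(3)[OF f(1,3)] A ft by blast
    then have "card (A \<union> B) \<le> card A" using union(2) A by (intro maxA) blast
    moreover have "card A < card (A \<union> B)"
      using B(1,2) bA finA finite_verts by (intro psubset_card_mono) (auto simp: tight_def)
    ultimately show False by simp
  qed
qed

end

section \<open>The greedy tour\<close>

context ribbon
begin

definition seen_edges :: "'e set \<Rightarrow> 'v \<times> 'e \<Rightarrow> nat \<Rightarrow> 'e set" where
  "seen_edges T d k = {f. \<exists>j<k. snd ((tour_step G T ^^ j) d) = f}"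

definition kept :: "'e set \<Rightarrow> 'v \<times> 'e \<Rightarrow> nat \<Rightarrow> 'e set" where
  "kept T d k = E - (seen_edges T d k - T)"

definition chips_left :: "('v \<Rightarrow> int) \<Rightarrow> 'e set \<Rightarrow> 'v \<times> 'e \<Rightarrow> nat \<Rightarrow> 'v \<Rightarrow> int" where
  "chips_left D T d k = (\<lambda>z. D z - (\<Sum>f\<in>E - kept T d k. of_bool (fcut d T f = z)))"

text \<open>The invariant of the tour after \<open>k\<close> steps. The tight sets record why each
  tree edge could not be cut when it was first examined; they are needed later, when another edge is
  forced into the tree.\<close>

definition greedy_upto :: "('v \<Rightarrow> int) \<Rightarrow> 'e set \<Rightarrow> 'v \<times> 'e \<Rightarrow> nat \<Rightarrow> bool" where
  "greedy_upto D T d k \<longleftrightarrow> feasible (kept T d k) (chips_left D T d k) \<and>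
     (\<forall>t\<in>T. \<forall>u. incident G u t \<longrightarrow> tp T d u t < k \<longrightarrow> tp T d u t < tp T d (other G u t) t \<longrightarrow>
        (\<exists>A. tight (kept T d k) (chips_left D T d k) A \<and> u \<in> A \<and> other G u t \<notin> A))"

lemma greedy_upto_0: "feasible E D \<Longrightarrow> greedy_upto D T d 0"
  by (simp add: greedy_upto_def kept_def chips_left_def seen_edges_def)

lemma seen_Suc: "seen_edges T d (Suc k) = insert (snd ((tour_step G T ^^ k) d)) (seen_edges T d k)"
  by (auto simp: seen_edges_def less_Suc_eq)

end

context tour
begin

lemma kept_same:
  assumes "(tour_step G T ^^ k) d = (x, f)" "f \<in> T \<or> f \<in> seen_edges T d k"
  shows "kept T d (Suc k) = kept T d k" "chips_left D T d (Suc k) = chips_left D T d k"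
proof -
  show "kept T d (Suc k) = kept T d k" using assms by (auto simp: kept_def seen_Suc)
  then show "chips_left D T d (Suc k) = chips_left D T d k" by (simp add: chips_left_def)
qed

lemma at_now:
  assumes k: "k < card (darts G)" and now: "(tour_step G T ^^ k) d = (x, f)"
  shows "incident G x f" "tp T d x f = k"
    "f \<notin> seen_edges T d k \<Longrightarrow> tp T d x f < tp T d (other G x f) f"
    "f \<in> seen_edges T d k \<Longrightarrow> tp T d (other G x f) f < tp T d x f"
proof -
  show x: "incident G x f" using dart_at[of k] now by simp
  show px: "tp T d x f = k" using tp_eqI[OF k now] .
  show "f \<notin> seen_edges T d k \<Longrightarrow> tp T d x f < tp T d (other G x f) f"
    "f \<in> seen_edges T d k \<Longrightarrow> tp T d (other G x f) f < tp T d x f"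
    using seen_iff[OF x, of k] k px tp_neq_other[OF x] unfolding seen_edges_def by auto
qed

lemma now_unique:
  assumes k: "k < card (darts G)" and now: "(tour_step G T ^^ k) d = (x, f)"
    and u: "incident G u t" "tp T d u t < Suc k" "(u, t) \<noteq> (x, f)"
  shows "tp T d u t < k"
  using tp_inj[OF u(1) at_now(1)[OF k now]] at_now(2)[OF k now] u by (metis less_SucE)

lemma greedy_seen:
  assumes g: "greedy_upto D T d k" and k: "k < card (darts G)"
    and now: "(tour_step G T ^^ k) d = (x, f)" and f: "f \<in> seen_edges T d k"
  shows "greedy_upto D T d (Suc k)"
proof -
  have "tp T d u t < k" if "incident G u t" "tp T d u t < Suc k" "tp T d u t < tp T d (other G u t) t" for u t
    using now_unique[OF k now that(1,2)] at_now(4)[OF k now f] that(3) by (metis Pair_inject less_asym)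
  then show ?thesis using g kept_same[OF now disjI2[OF f]] unfolding greedy_upto_def by metis
qed

lemma greedy_walk:
  assumes g: "greedy_upto D T d k" and k: "k < card (darts G)"
    and now: "(tour_step G T ^^ k) d = (x, f)" and f: "f \<in> T"
    and A: "tight (kept T d k) (chips_left D T d k) A" "x \<in> A" "other G x f \<notin> A"
  shows "greedy_upto D T d (Suc k)"
  unfolding greedy_upto_def kept_same[OF now disjI1[OF f]]
proof (intro conjI ballI allI impI)
  show "feasible (kept T d k) (chips_left D T d k)" using g by (simp add: greedy_upto_def)
  fix t u assume t: "t \<in> T" "incident G u t" "tp T d u t < Suc k" "tp T d u t < tp T d (other G u t) t"
  show "\<exists>A. tight (kept T d k) (chips_left D T d k) A \<and> u \<in> A \<and> other G u t \<notin> A"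
  proof (cases "(u, t) = (x, f)")
    case True
    then show ?thesis using A by blast
  next
    case False
    then show ?thesis using now_unique[OF k now t(2,3)] t g by (simp add: greedy_upto_def)
  qed
qed

text \<open>The chip removed at \<open>x\<close> is the one that \<open>eta\<close> assigns to
  \<open>f\<close>, and old tight sets survive by \<open>tight_remove\<close>.\<close>

lemma greedy_cut:
  assumes g: "greedy_upto D T d k" and k: "k < card (darts G)"
    and now: "(tour_step G T ^^ k) d = (x, f)" and f: "f \<notin> T" "f \<notin> seen_edges T d k"
    and feas: "feasible (kept T d k - {f}) (remove_chip (chips_left D T d k) x)"
  shows "greedy_upto D T d (Suc k)"
proof -
  note x = at_now(1,2)[OF k now] at_now(3)[OF k now f(2)]
  have fE: "f \<in> E" using incident_in(2)[OF x(1)] .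
  have eta: "fcut d T f = x" using eta_eq[OF _ x(1,3)] f fE by simp
  have keptE: "kept T d k \<subseteq> E" by (auto simp: kept_def)
  have fk: "f \<in> kept T d k" using f fE by (simp add: kept_def)
  have kept: "kept T d (Suc k) = kept T d k - {f}" using now f by (auto simp: kept_def seen_Suc)
  have "E - kept T d (Suc k) = insert f (E - kept T d k)" using kept fE by auto
  then have chips: "chips_left D T d (Suc k) = remove_chip (chips_left D T d k) x"
    using fk eta by (simp add: chips_left_def remove_chip_def fun_eq_iff)
  show ?thesis unfolding greedy_upto_def kept chips
  proof (intro conjI ballI allI impI)
    show "feasible (kept T d k - {f}) (remove_chip (chips_left D T d k) x)" by (rule feas)
    fix t u assume t: "t \<in> T" "incident G u t" "tp T d u t < Suc k" "tp T d u t < tp T d (other G u t) t"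
    have "tp T d u t < k" using now_unique[OF k now t(2,3)] f t by blast
    then obtain A where A: "tight (kept T d k) (chips_left D T d k) A" "u \<in> A" "other G u t \<notin> A"
      using g t by (auto simp: greedy_upto_def)
    then show "\<exists>A. tight (kept T d k - {f}) (remove_chip (chips_left D T d k) x) A \<and> u \<in> A \<and> other G u t \<notin> A"
      using tight_remove[OF keptE fk x(1) feas A(1)] by blast
  qed
qed

end

context two_tours
begin

lemma seen_agree: "t.seen_edges T d k = t.seen_edges T' d k"
  using iterates_agree by (auto simp: t.seen_edges_def)

lemma seen_status: "f \<in> t.seen_edges T d k \<Longrightarrow> f \<in> T \<longleftrightarrow> f \<in> T'"
  using agree by (auto simp: t.seen_edges_def)

lemma kept_agree: "t.kept T d k = t.kept T' d k"
  using seen_status by (auto simp: t.kept_def seen_agree[symmetric])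

lemma chips_left_agree: "t.chips_left D T d k = t.chips_left D T' d k"
proof -
  have "eta G (fst d) (snd d) T f = eta G (fst d) (snd d) T' f" if f: "f \<in> edges G - t.kept T d k" for f
  proof -
    have f': "f \<in> edges G - T" "f \<in> t.seen_edges T d k" using f by (auto simp: t.kept_def)
    then have fT': "f \<in> edges G - T'" using seen_status by blast
    have fE: "f \<in> edges G" using f by simp
    obtain u where u: "incident G u f"
      "pos (tour_step G T) d (u, f) < pos (tour_step G T) d (other G u f, f)"
      using t.first_dart[OF fE] .
    have "pos (tour_step G T) d (u, f) \<le> k"
      using t.seen_iff[OF u(1), of k] k u(2) f'(2) by (auto simp: t.seen_edges_def)
    then have "pos (tour_step G T') d (u, f) < pos (tour_step G T') d (other G u f, f)"
      using first_agree[OF u(1)] u(2) by simp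
    then show ?thesis using t.eta_eq[OF f'(1) u] t'.eta_eq[OF fT' u(1)] by simp
  qed
  then show ?thesis unfolding t.chips_left_def kept_agree[symmetric]
    by (intro ext arg_cong2[where f = "(-)"] sum.cong refl) (simp only:)
qed

text \<open>The invariant depends only on how examined edges are treated, so it survives an exchange
  of unexamined ones.\<close>

lemma greedy_agree:
  assumes g: "t.greedy_upto D T d k" shows "t.greedy_upto D T' d k"
  unfolding t.greedy_upto_def kept_agree[symmetric] chips_left_agree[symmetric]
proof (intro conjI ballI allI impI)
  show "t.feasible (t.kept T d k) (t.chips_left D T d k)" using g by (simp add: t.greedy_upto_def)
  fix s u assume s: "s \<in> T'" "incident G u s" "pos (tour_step G T') d (u, s) < k"
    "pos (tour_step G T') d (u, s) < pos (tour_step G T') d (other G u s, s)"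
  then have p: "pos (tour_step G T) d (u, s) \<le> k \<and>
      pos (tour_step G T) d (u, s) < pos (tour_step G T) d (other G u s, s)"
    using first_agree[OF s(2)] by simp
  moreover have lt: "pos (tour_step G T) d (u, s) < k" using tp_agree[OF s(2)] p s(3) by simp
  moreover have "s \<in> T"
    using agree[OF lt] t.tp_funpow[OF s(2)] s(1) by simp
  ultimately show "\<exists>A. t.tight (t.kept T d k) (t.chips_left D T d k) A \<and> u \<in> A \<and> other G u s \<notin> A"
    using g s(2) by (simp add: t.greedy_upto_def)
qed

end

context ribbon
begin

lemma two_toursI:
  assumes "T \<in> S G" "T' \<in> S G" "d \<in> darts G" "k < card (darts G)"
    and "\<And>f. f \<in> seen_edges T d k \<Longrightarrow> f \<in> T \<longleftrightarrow> f \<in> T'"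
  shows "two_tours G T T' d k"
  using assms by unfold_locales (auto simp: seen_edges_def)

lemma greedy_step:
  assumes T: "T \<in> S G" and d: "d \<in> darts G" and k: "k < card (darts G)"
    and g: "greedy_upto D T d k"
  shows "\<exists>T'\<in>S G. greedy_upto D T' d (Suc k)"
proof -
  interpret t: tour G T d using T d by unfold_locales
  obtain x f where now: "(tour_step G T ^^ k) d = (x, f)" by fastforce
  have x: "incident G x f" using t.at_now(1)[OF k now] .
  have fE: "f \<in> E" using incident_in(2)[OF x] .
  have feas: "feasible (kept T d k) (chips_left D T d k)" using g by (simp add: greedy_upto_def)
  have keptE: "kept T d k \<subseteq> E" by (auto simp: kept_def)
  show ?thesis
  proof (cases "f \<in> seen_edges T d k")
    case True
    then show ?thesis using t.greedy_seen[OF g k now] T by blast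
  next
    case unseen: False
    have fk: "f \<in> kept T d k" using unseen fE by (simp add: kept_def)
    have later: "tp T d x f < tp T d (other G x f) f" using t.at_now(3)[OF k now unseen] .
    show ?thesis
    proof (cases "feasible (kept T d k - {f}) (remove_chip (chips_left D T d k) x)")
      case cut_ok: True
      show ?thesis
      proof (cases "f \<in> T")
        case False
        then show ?thesis using t.greedy_cut[OF g k now False unseen cut_ok] T by blast
      next
        case fT: True
        \<comment> \<open>The edge has to be cut although it lies in \<open>T\<close>. What is kept
          without \<open>f\<close> is feasible, hence connected, so it has an edge \<open>h\<close>
          across the fundamental cut of \<open>f\<close>. Kept and outside \<open>T\<close>, it is
          unexamined and can replace \<open>f\<close>.\<close>
        define B where "B = {u\<in>V. reach G (T - {f}) (other G x f) u}"
        have "other G x f \<in> B" using incident_in(1)[OF other_incident[OF x]] by (simp add: B_def reach_refl)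
        moreover have "x \<notin> B" using acyclic_bridge[OF t.T_acyc fT x] reach_sym by (auto simp: B_def)
        then have "B \<noteq> V" using incident_in(1)[OF x] by blast
        ultimately obtain h where h: "h \<in> cut (kept T d k - {f}) B"
          using feasible_connected[OF _ cut_ok, of B] keptE B_def by blast
        have hf: "h \<noteq> f" "h \<in> kept T d k" "h \<in> E" using h keptE by (auto simp: cut_def)
        then have hT: "h \<notin> T" using t.fundamental_cut[OF fT B_def, of h] h by (auto simp: cut_def)
        then have hs: "h \<notin> seen_edges T d k" using hf by (auto simp: kept_def)
        have "\<not> reach G (T - {f}) (tl_end h) (hd_end h)"
        proof
          assume r: "reach G (T - {f}) (tl_end h) (hd_end h)"
          have "tl_end h \<in> B \<longleftrightarrow> hd_end h \<in> B"
            using ends_in[OF hf(3)] reach_trans[OF _ r] reach_trans[OF _ reach_sym[OF r]]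
            unfolding B_def by blast
          then show False using h by (simp add: cut_def)
        qed
        then have T': "insert h (T - {f}) \<in> S G" using tree_exchange[OF T fT] hf(3) hT by blast
        interpret tt: two_tours G T "insert h (T - {f})" d k
          using two_toursI[OF T T' d k] unseen hs by blast
        have now': "(tour_step G (insert h (T - {f})) ^^ k) d = (x, f)"
          using tt.iterates_agree[of k] now by simp
        have "greedy_upto D (insert h (T - {f})) d (Suc k)"
          using tt.t'.greedy_cut[OF tt.greedy_agree[OF g] k now'] hf(1) unseen cut_ok
          unfolding tt.seen_agree tt.kept_agree tt.chips_left_agree by blast
        then show ?thesis using T' by blast
      qed
    next
      case cut_bad: False
      obtain A where A: "tight (kept T d k) (chips_left D T d k) A" "x \<in> A" "other G x f \<notin> A"
        using not_feasible_remove[OF keptE fk x feas cut_bad] .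
      show ?thesis
      proof (cases "f \<in> T")
        case True
        then show ?thesis using t.greedy_walk[OF g k now True A] T by blast
      next
        case fT: False
        \<comment> \<open>The edge has to be walked although it is outside \<open>T\<close>. Since
          examined tree edges alone do not join its ends, the tree path between them has an
          unexamined edge that \<open>f\<close> can replace.\<close>
        have "\<not> reach G (T \<inter> seen_edges T d k) x (other G x f)"
        proof (rule t.tight_blocks_seen_path[OF keptE _ _ feas fk fT x later A])
          show "T \<inter> seen_edges T d k \<subseteq> kept T d k" using t.T_sub by (auto simp: kept_def)
          fix s u assume s: "s \<in> T \<inter> seen_edges T d k" "incident G u s" "tp T d u s < tp T d (other G u s) s"
          then have "tp T d u s < k"
            using t.seen_iff[OF s(2), of k] k by (auto simp: seen_edges_def)
          then show "tp T d u s < tp T d x f \<and>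
              (\<exists>B. tight (kept T d k) (chips_left D T d k) B \<and> u \<in> B \<and> other G u s \<notin> B)"
            using g s t.at_now(2)[OF k now] by (auto simp: greedy_upto_def)
        qed simp
        moreover have "reach G T x (other G x f)"
          using t.T_conn incident_in(1) x other_incident[OF x] by (auto simp: connected_by_def)
        ultimately obtain s where s: "s \<in> T" "s \<notin> seen_edges T d k" "\<not> reach G (T - {s}) x (other G x f)"
          using separating_edge[OF t.T_acyc] by blast
        have "x = tl_end f \<and> other G x f = hd_end f \<or> x = hd_end f \<and> other G x f = tl_end f"
          using x other_ends[OF fE] by (auto simp: incident_def)
        then have "\<not> reach G (T - {s}) (tl_end f) (hd_end f)" using s(3) reach_sym by auto
        then have T': "insert f (T - {s}) \<in> S G" using tree_exchange[OF T s(1)] fE fT by blast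
        interpret tt: two_tours G T "insert f (T - {s})" d k
          using two_toursI[OF T T' d k] unseen s(2) by blast
        have now': "(tour_step G (insert f (T - {s})) ^^ k) d = (x, f)"
          using tt.iterates_agree[of k] now by simp
        have "greedy_upto D (insert f (T - {s})) d (Suc k)"
          using tt.t'.greedy_walk[OF tt.greedy_agree[OF g] k now' _ _ A(2,3)] A(1)
          unfolding tt.kept_agree tt.chips_left_agree by blast
        then show ?thesis using T' by blast
      qed
    qed
  qed
qed

lemma bernardi_surj:
  assumes d: "d \<in> darts G" and S: "S G \<noteq> {}" and D: "feasible E D" "D \<in> divisors G"
  shows "\<exists>T\<in>S G. bd d T = D"
proof -
  have "k \<le> card (darts G) \<Longrightarrow> \<exists>T\<in>S G. greedy_upto D T d k" for k
  proof (induction k)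
    case 0
    then show ?case using S greedy_upto_0[OF D(1)] by blast
  next
    case (Suc k)
    then obtain T where "T \<in> S G" "greedy_upto D T d k" by auto
    then show ?case using greedy_step[OF _ d] Suc.prems by auto
  qed
  then obtain T where T: "T \<in> S G" and g: "greedy_upto D T d (card (darts G))" by blast
  interpret t: tour G T d using T d by unfold_locales
  have "f \<in> seen_edges T d (card (darts G))" if f: "f \<in> E" for f
    using t.seen_iff[OF incident_ends(1)[OF f], of "card (darts G)"] t.tp_less[OF incident_ends(1)[OF f]]
    by (simp add: seen_edges_def)
  then have kept: "kept T d (card (darts G)) = T" using t.T_sub by (auto simp: kept_def)
  let ?R = "chips_left D T d (card (darts G))"
  have R: "?R z = D z - bd d T z" for z by (simp add: chips_left_def kept bernardi_sum)
  have feas: "feasible T ?R" using g kept by (simp add: greedy_upto_def)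
  \<comment> \<open>All edges are decided, so the leftover divisor is feasible on the tree: single
    vertices give nonnegative values, and the total is 0, hence nothing is left.\<close>
  have nonneg: "0 \<le> ?R z" if z: "z \<in> V" for z
  proof -
    have "ins T {z} = {}" using ends_neq t.T_sub by (fastforce simp: ins_def)
    then show ?thesis using feasible_lower[OF feas, of "{z}"] z by simp
  qed
  have "sum ?R V = 0" using feasible_total[OF feas] tree_card[OF T t.V_nonempty] by simp
  then have zero: "?R z = 0" if "z \<in> V" for z
    using sum_nonneg_eq_0_iff[OF finite_V, of ?R] nonneg that by blast
  have "bd d T z = D z" for z
  proof (cases "z \<in> V")
    case True
    then show ?thesis using zero R by simp
  next
    case False
    then have "fcut d T f \<noteq> z" if "f \<in> E - T" for f using t.eta_incident[OF that] incident_in by blast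
    then have "bd d T z = 0" by (simp add: bernardi_sum)
    then show ?thesis using False D(2) by (simp add: divisors_def)
  qed
  then show ?thesis using T by blast
qed

section \<open>Linear equivalence and the action on trees\<close>

lemma lin_equiv_iff: "lin_equiv G D D' \<longleftrightarrow> (\<exists>h. \<forall>z. D z - D' z = laplacian G h z)"
  by (simp add: lin_equiv_def fun_eq_iff)

lemma lin_equiv_sym: "lin_equiv G D D' \<Longrightarrow> lin_equiv G D' D"
  unfolding lin_equiv_iff using laplacian_minus by (metis minus_diff_eq)

lemma lin_equiv_trans:
  assumes "lin_equiv G D D'" "lin_equiv G D' D''" shows "lin_equiv G D D''"
proof -
  obtain h h' where h: "\<And>z. D z - D' z = laplacian G h z" "\<And>z. D' z - D'' z = laplacian G h' z"
    using assms by (auto simp: lin_equiv_iff)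
  have "D z - D'' z = laplacian G (\<lambda>u. h u + h' u) z" for z
    unfolding laplacian_add using h[of z] by simp
  then show ?thesis by (auto simp: lin_equiv_iff)
qed

text \<open>This replaces the choice operators by a description: the image of \<open>T\<close> is
  the only tree whose Bernardi divisor is equivalent to that of \<open>T\<close> plus
  \<open>\<gamma>\<close>. Surjectivity gives existence, injectivity and uniqueness of feasible
  divisors the rest.\<close>

lemma bernardi_action_unique:
  assumes d: "d \<in> darts G" and \<gamma>: "\<gamma> \<in> divisors G" "deg G \<gamma> = 0" and T: "T \<in> S G"
  shows "bernardi_action G (fst d) (snd d) \<gamma> T \<in> S G"
    and "lin_equiv G (bd d (bernardi_action G (fst d) (snd d) \<gamma> T)) (\<lambda>x. bd d T x + \<gamma> x)"
    and "T' \<in> S G \<Longrightarrow> lin_equiv G (bd d T') (\<lambda>x. bd d T x + \<gamma> x) \<Longrightarrow>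
      bernardi_action G (fst d) (snd d) \<gamma> T = T'"
proof -
  have V: "V \<noteq> {}" using d incident_in by (fastforce simp: darts_def)
  have break: "bd d T \<in> break_divisors G" if "T \<in> S G" for T
  proof -
    interpret tour G T d using that d by unfold_locales
    show ?thesis by (rule bernardi_break)
  qed
  note feas = break_divisor_feasible[OF _ V]
  define D where "D = (\<lambda>x. bd d T x + \<gamma> x)"
  have unique: "D' = D''" if "D' \<in> break_divisors G" "D'' \<in> break_divisors G"
    "lin_equiv G D' D" "lin_equiv G D'' D" for D' D''
  proof -
    have "lin_equiv G D' D''" using that lin_equiv_sym lin_equiv_trans by blast
    then show ?thesis using feasible_unique[OF feas feas _ V] that by (auto simp: lin_equiv_def)
  qed
  have act: "bernardi_action G (fst d) (snd d) \<gamma> T = T'"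
    if T': "T' \<in> S G" "lin_equiv G (bd d T') D" for T'
  proof -
    have "break_act G \<gamma> (bd d T) = bd d T'"
      unfolding break_act_def D_def[symmetric] using unique break T' by (intro the_equality) blast+
    moreover have "inv_into (S G) (bd d) (bd d T') = T'"
      using bernardi_inj[OF _ _ d] T' by (intro inv_into_f_f) (auto simp: inj_on_def)
    ultimately show ?thesis by (simp add: bernardi_action_def)
  qed
  have "sum D V = int (card E) - int (card V) + 1"
    using feasible_total[OF feas[OF break[OF T]]] \<gamma>(2) by (simp add: D_def deg_def sum.distrib)
  then obtain h where h: "feasible E (\<lambda>u. D u - laplacian G h u)" using feasible_exists[OF V] by blast
  have "laplacian G h z = 0" if "z \<notin> V" for z
    unfolding laplacian_def inc_edges_def using that incident_in(1) by (intro sum.neutral) blast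
  moreover have "bd d T z = 0" if "z \<notin> V" for z
  proof -
    interpret tour G T d using T d by unfold_locales
    have "fcut d T f \<noteq> z" if "f \<in> E - T" for f using eta_incident[OF that] incident_in(1) \<open>z \<notin> V\<close> by blast
    then show ?thesis by (simp add: bernardi_sum)
  qed
  ultimately have "(\<lambda>u. D u - laplacian G h u) \<in> divisors G"
    using \<gamma>(1) by (simp add: divisors_def D_def)
  then obtain T1 where T1: "T1 \<in> S G" "bd d T1 = (\<lambda>u. D u - laplacian G h u)"
    using bernardi_surj[OF d _ h] T by blast
  then have "lin_equiv G (bd d T1) D"
    unfolding lin_equiv_iff using laplacian_minus[of h] by (intro exI[of _ "\<lambda>u. - h u"]) simp
  then show "bernardi_action G (fst d) (snd d) \<gamma> T \<in> S G"
    "lin_equiv G (bd d (bernardi_action G (fst d) (snd d) \<gamma> T)) (\<lambda>x. bd d T x + \<gamma> x)"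
    using act[OF T1(1)] T1(1) by (simp_all add: D_def)
  show "T' \<in> S G \<Longrightarrow> lin_equiv G (bd d T') (\<lambda>x. bd d T x + \<gamma> x) \<Longrightarrow>
      bernardi_action G (fst d) (snd d) \<gamma> T = T'"
    using act by (simp add: D_def)
qed

end

theorem theorem5p1:
  fixes G :: "('v,'e) rgraph"
  assumes "ribbon_graph G" and "planar G"
    and "v \<in> verts G" and "incident G v e"
    and "v' \<in> verts G" and "incident G v' e'"
    and "\<gamma> \<in> divisors G" and "deg G \<gamma> = 0"
    and "T \<in> S G"
  shows "bernardi_action G v e \<gamma> T = bernardi_action G v' e' \<gamma> T"
proof -
  interpret ribbon G using assms(1) by unfold_locales
  have d: "(v, e) \<in> darts G" and d': "(v', e') \<in> darts G" using assms by (simp_all add: darts_iff)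
  define T1 where "T1 = bernardi_action G v' e' \<gamma> T"
  have T1: "T1 \<in> S G" "lin_equiv G (bernardi G v' e' T1) (\<lambda>x. bernardi G v' e' T x + \<gamma> x)"
    using bernardi_action_unique(1,2)[OF d' assms(7-9)] by (simp_all add: T1_def)
  obtain h where h: "\<And>z. bernardi G v' e' T1 z - (bernardi G v' e' T z + \<gamma> z) = laplacian G h z"
    using T1(2) by (auto simp: lin_equiv_iff)
  obtain c where c: "\<forall>T\<in>S G. \<exists>h. \<forall>z. bernardi G v e T z - bernardi G v' e' T z = c z + laplacian G h z"
    using planar_start_independent[OF assms(2) d' d] by auto
  obtain h0 where h0: "\<And>z. bernardi G v e T z - bernardi G v' e' T z = c z + laplacian G h0 z"
    using c assms(9) by blast
  obtain h1 where h1: "\<And>z. bernardi G v e T1 z - bernardi G v' e' T1 z = c z + laplacian G h1 z"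
    using c T1(1) by blast
  \<comment> \<open>The same \<open>c\<close> occurs for \<open>T\<close> and for \<open>T1\<close>
    and cancels, so the image found from \<open>(v', e')\<close> also fits the description at
    \<open>(v, e)\<close>.\<close>
  have "bernardi G v e T1 z - (bernardi G v e T z + \<gamma> z)
      = laplacian G (\<lambda>u. h u + (h1 u + - h0 u)) z" for z
    unfolding laplacian_add laplacian_minus using h[of z] h0[of z] h1[of z] by linarith
  then have "lin_equiv G (bernardi G v e T1) (\<lambda>x. bernardi G v e T x + \<gamma> x)"
    by (auto simp: lin_equiv_iff)
  then show ?thesis
    using bernardi_action_unique(3)[OF d assms(7-9) T1(1)] by (simp add: T1_def)
qed

end
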